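(* For every $\theta$ with $0<\theta\le\pi$ and every $s$ with $0<s<1$, $$\left|b_s(\theta)-\frac14\right|\le 50000\, s\,\theta^{-2-2s},$$ where $b_s(\theta)$ is the angular part of the Boltzmann collision kernel of the inverse power potential $U(r)=r^{-1/s}$, i.e. $$b_s(\theta)=\frac{2^{4s}}{2}\,\frac{1}{\sin\theta}\,\beta_s(y_s(\varphi))\,\beta_s'(y_s(\varphi))\,y_s'(\varphi),\qquad \varphi=\frac{\pi-\theta}{2},$$ with $\beta_s$ and $y_s$ as defined in the context.
   Context: Fix $0<s<1$. The function $\beta_s$ is $\beta_s(y)=\dfrac{y}{(1-y^2)^s}$ for $y\in[0,1)$, with derivative $\beta_s'(y)=2s(1-y^2)^{-1-s}+(1-2s)(1-y^2)^{-s}$. For $y,z\in[0,1]$ put $g(s,y,z)=1-z^{1/s}-y^2(z^2-z^{1/s})$ and define $$\varphi_s(y)=y\int_0^1\frac{dz}{\sqrt{g(s,y,z)}},\qquad y\in[0,1].$$ The function $\varphi_s$ is strictly increasing from $[0,1]$ onto $[0,\pi/2]$, with $\varphi_s'(y)=\int_0^1\frac{1-z^{1/s}}{g(s,y,z)^{3/2}}dz>0$. Its inverse function is denoted $y_s:[0,\pi/2]\to[0,1]$, so $y_s'(\varphi)=1/\varphi_s'(y_s(\varphi))$ (one-sided derivatives at endpoints). The angles $\theta\in(0,\pi]$ and $\varphi\in[0,\pi/2)$ are related by $2\varphi+\theta=\pi$. At $\theta=\pi$ (where $\varphi=0$, $y_s(\varphi)=0$ and $\sin\theta=0$) the formula for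 $b_s$ is of the form $0/0$ and $b_s(\pi)$ is understood as the limit $\lim_{\theta\to\pi^-}b_s(\theta)$. *)

theory Defs
  imports "HOL-Analysis.Analysis"
begin

definition beta_fn :: "real \<Rightarrow> real \<Rightarrow> real" where
  "beta_fn s y = y / (1 - y\<^sup>2) powr s"

definition g_fn :: "real \<Rightarrow> real \<Rightarrow> real \<Rightarrow> real" where
  "g_fn s y z = 1 - z powr (1 / s) - y\<^sup>2 * (z\<^sup>2 - z powr (1 / s))"

text \<open>The integrand below is nonnegative; at the null set where \<open>g_fn\<close> vanishes, division
  by zero makes it 0, which does not affect the integral.\<close>

definition phi_fn :: "real \<Rightarrow> real \<Rightarrow> real" where
  "phi_fn s y = y * integral {0..1} (\<lambda>z. 1 / sqrt (g_fn s y z))"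

definition y_fn :: "real \<Rightarrow> real \<Rightarrow> real" where
  "y_fn s = the_inv_into {0..1} (phi_fn s)"

text \<open>For \<open>0 < \<theta> < pi\<close> the angle \<open>(pi - \<theta>) / 2\<close> lies in the open interval \<open>(0, pi / 2)\<close>
  and \<open>y_fn s\<close> maps it into \<open>(0, 1)\<close>, so only ordinary two-sided derivatives occur.\<close>

definition b_formula :: "real \<Rightarrow> real \<Rightarrow> real" where
  "b_formula s \<theta> =
     (let \<phi> = (pi - \<theta>) / 2
      in 2 powr (4 * s) / 2 * (1 / sin \<theta>) * beta_fn s (y_fn s \<phi>)
           * deriv (beta_fn s) (y_fn s \<phi>) * deriv (y_fn s) \<phi>)"

text \<open>At \<open>\<theta> = pi\<close> the formula is of the form \<open>0 / 0\<close>; the value there is the left limit.\<close>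

definition b_fn :: "real \<Rightarrow> real \<Rightarrow> real" where
  "b_fn s \<theta> = (if \<theta> = pi then Lim (at_left pi) (b_formula s) else b_formula s \<theta>)"

end

theory Submission imports Defs begin

text \<open>
  Put \<open>e = 1 - y\<^sup>2\<close>, \<open>w = z powr (1 / s)\<close> and \<open>t = 1 - z\<close>. The function \<open>g = g_fn s y z\<close> is the
  convex combination \<open>e * (1 - w) + y\<^sup>2 * (1 - z\<^sup>2)\<close> and equals \<open>g0 - e * w\<close> with
  \<open>g0 = 1 - y\<^sup>2 * z\<^sup>2\<close>; hence \<open>max t (g0 * (1 - w)) \<le> g \<le> g0\<close>, while \<open>1 - w\<close> lies between
  \<open>t / (s + t)\<close> and \<open>2 * t / (s + t)\<close>. For \<open>w = 0\<close> the integrals are elementary, giving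
  \<open>\<phi> = arcsin y\<close>, \<open>\<phi>' = 1 / sqrt e\<close> and \<open>b = 1 / 4\<close>.

  If \<open>4 * s < e\<close>, then \<open>\<phi>\<close> and \<open>\<phi>'\<close> differ from these values by a relative error of order
  \<open>s / e\<close>, because \<open>w / sqrt (1 - w)\<close> has integral at most \<open>2 * s\<close>; since \<open>\<theta> \<le> pi * sqrt e\<close>,
  this is the claim. If \<open>e \<le> 4 * s\<close>, then \<open>\<phi>'\<close> is comparable with \<open>1 / sqrt s\<close> on the whole
  remaining interval, so that \<open>\<theta>\<close> is comparable with \<open>e / sqrt s\<close>, and \<open>b\<close> and \<open>1 / 4\<close>
  separately obey the bound. For \<open>s \<ge> 1 / 2\<close> cruder bounds on \<open>\<phi>'\<close> keep the constant below
  50000. At \<open>\<theta> = pi\<close> one passes to the limit.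
\<close>

subsection \<open>Integrals dominated by an inverse square root\<close>

text \<open>With \<open>w = z powr (1 / s)\<close>, Young's inequality for
  \<open>w powr s = z\<close> gives \<open>z \<le> s * w + (1 - s)\<close>, which is the upper
  bound. The lower bound comes from \<open>ln z \<le> z - 1\<close> and
  \<open>exp u \<ge> 1 + u\<close>.\<close>

lemma powr_inverse_bounds:
  fixes s z :: real
  assumes "0 < s" "s < 1" "0 < z" "z < 1"
  shows powr_inverse_pos: "0 < z powr (1 / s)"
    and powr_inverse_le: "z powr (1 / s) \<le> z"
    and powr_inverse_upper: "1 - z powr (1 / s) \<le> (1 - z) / s"
    and powr_inverse_lower: "(1 - z) / (s + (1 - z)) \<le> 1 - z powr (1 / s)"
proof -
  define w where "w = z powr (1 / s)"
  show w0: "0 < z powr (1 / s)" using assms by simp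
  have "z powr (1 / s) \<le> z powr 1"
    using assms by (intro powr_mono') (auto simp: field_simps)
  then show "z powr (1 / s) \<le> z" using assms by simp
  have ws: "w powr s = z" using assms by (simp add: w_def powr_powr)
  have "w powr s * 1 powr (1 - s) \<le> s * w + (1 - s) * 1"
    using assms w0 by (intro Youngs_inequality_0) (auto simp: w_def)
  then have "z \<le> s * w + (1 - s)" using ws by simp
  then show "1 - z powr (1 / s) \<le> (1 - z) / s"
    using assms by (simp add: w_def field_simps)
  have "w = exp (ln z / s)" using assms by (simp add: w_def powr_def)
  also have "\<dots> \<le> exp (- ((1 - z) / s))"
    using assms ln_le_minus_one[of z] by (simp add: field_simps)
  also have "\<dots> \<le> 1 / (1 + (1 - z) / s)"
  proof -
    have "1 + (1 - z) / s \<le> exp ((1 - z) / s)" by (rule exp_ge_add_one_self)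
    moreover have "0 < 1 + (1 - z) / s" using assms by (intro add_pos_pos) auto
    ultimately show ?thesis by (simp add: exp_minus field_simps)
  qed
  finally have "w \<le> s / (s + (1 - z))" using assms by (simp add: field_simps)
  then show "(1 - z) / (s + (1 - z)) \<le> 1 - z powr (1 / s)"
    using assms by (simp add: w_def field_simps)
qed

lemma has_integral_inverse_sqrt:
  "((\<lambda>z. 1 / sqrt (1 - z)) has_integral 2) {0<..<1::real}"
proof -
  have "((\<lambda>z. 1 / sqrt (1 - z)) has_integral (-2 * sqrt (1 - 1) - -2 * sqrt (1 - 0))) {0..1::real}"
    by (rule fundamental_theorem_of_calculus_interior)
       (auto intro!: continuous_intros derivative_eq_intros
          simp flip: has_real_derivative_iff_has_vector_derivative simp: field_simps)
  then show ?thesis by (simp add: has_integral_Icc_iff_Ioo)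
qed

lemma integrable_on_const_over_sqrt:
  "(\<lambda>z. C / sqrt (1 - z)) integrable_on {0<..<1::real}"
  using has_integral_mult_right[OF has_integral_inverse_sqrt, of C] by auto

text \<open>A multiple of \<open>1 / sqrt (1 - z)\<close> majorises the integrand of the deflection
  integral and, for \<open>y < 1\<close>, that of its derivative, so that only measurability has to
  be checked.\<close>

lemma integrable_on_inverse_sqrt_bound:
  fixes f :: "real \<Rightarrow> real"
  assumes "f \<in> borel_measurable borel"
    and "\<And>z. 0 < z \<Longrightarrow> z < 1 \<Longrightarrow> \<bar>f z\<bar> \<le> C / sqrt (1 - z)"
  shows "f integrable_on {0<..<1}"
proof (rule measurable_bounded_by_integrable_imp_integrable)
  show "f \<in> borel_measurable (lebesgue_on {0<..<1})"
    using assms(1) by (intro measurable_restrict_space1 measurable_completion) simp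
  show "(\<lambda>z. C / sqrt (1 - z)) integrable_on {0<..<1}"
    by (rule integrable_on_const_over_sqrt)
qed (use assms in auto)

text \<open>Continuity is tested on sequences, where dominated convergence applies because the
  majorant does not depend on \<open>y\<close>.\<close>

lemma continuous_on_integral_dominated:
  fixes f :: "real \<Rightarrow> real \<Rightarrow> real"
  assumes f: "\<And>y. y \<in> S \<Longrightarrow> f y \<in> borel_measurable borel"
    and bd: "\<And>y z. y \<in> S \<Longrightarrow> 0 < z \<Longrightarrow> z < 1 \<Longrightarrow> \<bar>f y z\<bar> \<le> C / sqrt (1 - z)"
    and c: "\<And>z. 0 < z \<Longrightarrow> z < 1 \<Longrightarrow> continuous_on S (\<lambda>y. f y z)"
  shows "continuous_on S (\<lambda>y. integral {0<..<1} (f y))"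
  unfolding continuous_on_sequentially o_def
proof (intro allI impI ballI, elim conjE)
  fix x :: "nat \<Rightarrow> real" and a
  assume a: "a \<in> S" and x: "\<forall>n. x n \<in> S" "x \<longlonglongrightarrow> a"
  show "(\<lambda>n. integral {0<..<1} (f (x n))) \<longlonglongrightarrow> integral {0<..<1} (f a)"
  proof (rule dominated_convergence)
    show "f (x n) integrable_on {0<..<1}" for n
      using f bd x by (intro integrable_on_inverse_sqrt_bound) blast+
    show "(\<lambda>z. C / sqrt (1 - z)) integrable_on {0<..<1}"
      by (rule integrable_on_const_over_sqrt)
    show "norm (f (x n) z) \<le> C / sqrt (1 - z)" if "z \<in> {0<..<1}" for n z
      using bd[of "x n" z] x that by simp
    show "(\<lambda>n. f (x n) z) \<longlonglongrightarrow> f a z" if "z \<in> {0<..<1}" for z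
      using c[of z] that a x unfolding continuous_on_sequentially o_def by auto
  qed
qed

text \<open>The difference quotient, extended by the derivative at \<open>a\<close>, is continuous in \<open>y\<close> and
  dominated because of the mean value theorem; so the claim reduces to
  \<open>continuous_on_integral_dominated\<close>.\<close>

lemma has_field_derivative_integral_dominated:
  fixes f f' :: "real \<Rightarrow> real \<Rightarrow> real"
  assumes a: "a \<in> {c<..<d}"
    and f: "\<And>y. y \<in> {c<..<d} \<Longrightarrow> f y integrable_on {0<..<1}"
    and meas: "\<And>y. y \<in> {c<..<d} \<Longrightarrow> f y \<in> borel_measurable borel" "f' a \<in> borel_measurable borel"
    and der: "\<And>y z. y \<in> {c<..<d} \<Longrightarrow> 0 < z \<Longrightarrow> z < 1 \<Longrightarrow>
      ((\<lambda>y. f y z) has_real_derivative f' y z) (at y)"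
    and bd: "\<And>y z. y \<in> {c<..<d} \<Longrightarrow> 0 < z \<Longrightarrow> z < 1 \<Longrightarrow> \<bar>f' y z\<bar> \<le> C / sqrt (1 - z)"
  shows "((\<lambda>y. integral {0<..<1} (f y)) has_real_derivative integral {0<..<1} (f' a)) (at a)"
proof -
  define q where "q y z = (if y = a then f' a z else (f y z - f a z) / (y - a))" for y z
  have mvt: "\<exists>u\<in>{c<..<d}. f y z - f a z = (y - a) * f' u z"
    if "y \<in> {c<..<d}" "y \<noteq> a" "0 < z" "z < 1" for y z
  proof (cases "y < a")
    case True
    have "\<exists>u>y. u < a \<and> f a z - f y z = (a - y) * f' u z"
      by (rule MVT2[OF True]) (use der that a in auto)
    then obtain u where "u > y" "u < a" "f a z - f y z = (a - y) * f' u z" by blast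
    then show ?thesis using a that by (intro bexI[of _ u]) (auto simp: algebra_simps)
  next
    case False
    have "\<exists>u>a. u < y \<and> f y z - f a z = (y - a) * f' u z"
      by (rule MVT2) (use False der that a in auto)
    then obtain u where "u > a" "u < y" "f y z - f a z = (y - a) * f' u z" by blast
    then show ?thesis using a that by (intro bexI[of _ u]) auto
  qed
  have "continuous_on {c<..<d} (\<lambda>y. integral {0<..<1} (q y))"
  proof (rule continuous_on_integral_dominated)
    show "q y \<in> borel_measurable borel" if "y \<in> {c<..<d}" for y
      using meas that a unfolding q_def by (cases "y = a") (auto intro!: borel_measurable_divide borel_measurable_diff)
    show "\<bar>q y z\<bar> \<le> C / sqrt (1 - z)" if yz: "y \<in> {c<..<d}" "0 < z" "z < 1" for y z
    proof (cases "y = a")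
      case True
      then show ?thesis using bd yz a by (simp add: q_def)
    next
      case False
      then obtain u where "u \<in> {c<..<d}" "f y z - f a z = (y - a) * f' u z"
        using mvt[OF yz(1) False yz(2,3)] by blast
      then show ?thesis using bd[of u z] yz False by (simp add: q_def)
    qed
    show "continuous_on {c<..<d} (\<lambda>y. q y z)" if z: "0 < z" "z < 1" for z
    proof (rule continuous_at_imp_continuous_on, rule ballI)
      fix y assume y: "y \<in> {c<..<d}"
      show "isCont (\<lambda>y. q y z) y"
      proof (cases "y = a")
        case True
        have "((\<lambda>y. (f y z - f a z) / (y - a)) \<longlongrightarrow> f' a z) (at a)"
          using der[OF a z] by (simp add: has_field_derivative_iff)
        then have "((\<lambda>y. q y z) \<longlongrightarrow> f' a z) (at a)"
          by (rule Lim_transform_eventually) (auto simp: q_def eventually_at_filter)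
        then show ?thesis using True by (simp add: isCont_def q_def)
      next
        case False
        have "isCont (\<lambda>y. (f y z - f a z) / (y - a)) y"
          using der[OF y z] False by (intro continuous_intros DERIV_isCont) auto
        moreover have "eventually (\<lambda>x. q x z = (f x z - f a z) / (x - a)) (nhds y)"
          using t1_space_nhds[OF False] by eventually_elim (simp add: q_def)
        ultimately show ?thesis using isCont_cong by fast
      qed
    qed
  qed
  then have "isCont (\<lambda>y. integral {0<..<1} (q y)) a"
    using a by (simp add: continuous_on_eq_continuous_at)
  then have "((\<lambda>y. integral {0<..<1} (q y)) \<longlongrightarrow> integral {0<..<1} (f' a)) (at a)"
    by (simp add: isCont_def q_def cong: integral_cong)
  moreover have "eventually (\<lambda>y. integral {0<..<1} (q y) =
      (integral {0<..<1} (f y) - integral {0<..<1} (f a)) / (y - a)) (at a)"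
  proof -
    have "eventually (\<lambda>y. y \<in> {c<..<d} \<and> y \<noteq> a) (at a)"
      using a by (auto simp: eventually_at_filter intro!: eventually_mono[OF eventually_nhds_in_open[of "{c<..<d}" a]])
    then show ?thesis
    proof eventually_elim
      case (elim y)
      then have "q y = (\<lambda>z. (f y z - f a z) / (y - a))" by (auto simp: q_def)
      then have "integral {0<..<1} (q y) = integral {0<..<1} (\<lambda>z. (f y z - f a z) / (y - a))"
        by (rule arg_cong)
      also have "\<dots> = (integral {0<..<1} (f y) - integral {0<..<1} (f a)) / (y - a)"
        using f[of y] f[OF a] elim by (simp add: Henstock_Kurzweil_Integration.integral_diff)
      finally show ?case .
    qed
  qed
  ultimately show ?thesis
    unfolding has_field_derivative_iff by (rule Lim_transform_eventually)
qed

subsection \<open>The deflection integral and its derivative\<close>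

text \<open>Differentiation of the integrand of \<open>phi_fn\<close> gives this formula. The power
  3/2 of \<open>g_fn\<close> is written as a product, and the open interval leaves out
  \<open>z = 1\<close>, where \<open>g_fn\<close> vanishes.\<close>

definition dphi_fn :: "real \<Rightarrow> real \<Rightarrow> real" where
  "dphi_fn s y =
     integral {0<..<1} (\<lambda>z. (1 - z powr (1 / s)) / (g_fn s y z * sqrt (g_fn s y z)))"

lemma g_fn_convex:
  "g_fn s y z = (1 - y\<^sup>2) * (1 - z powr (1 / s)) + y\<^sup>2 * (1 - z\<^sup>2)"
  by (simp add: g_fn_def algebra_simps)

lemma borel_measurable_g_fn [measurable]: "g_fn s y \<in> borel_measurable borel"
  unfolding g_fn_def[abs_def] by measurable

section \<open>Antiderivatives of the comparison integrands\<close>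

lemma has_integral_arcsin:
  fixes y :: real
  assumes "0 < y" "y \<le> 1"
  shows "((\<lambda>z. y / sqrt (1 - y\<^sup>2 * z\<^sup>2)) has_integral arcsin y) {0<..<1}"
proof -
  have "((\<lambda>z. y / sqrt (1 - y\<^sup>2 * z\<^sup>2)) has_integral (arcsin (y * 1) - arcsin (y * 0))) {0..1}"
  proof (rule fundamental_theorem_of_calculus_interior)
    show "continuous_on {0..1} (\<lambda>z. arcsin (y * z))"
    proof (intro continuous_intros ballI conjI)
      fix z :: real assume "z \<in> {0..1}"
      then have "0 \<le> y * z" "y * z \<le> 1" using assms by (simp_all add: mult_le_one)
      then show "- 1 \<le> y * z" "y * z \<le> 1" by simp_all
    qed
    show "((\<lambda>z. arcsin (y * z)) has_vector_derivative y / sqrt (1 - y\<^sup>2 * z\<^sup>2)) (at z)"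
      if "z \<in> {0<..<1}" for z
    proof -
      have "y * z \<le> 1 * z" using that assms by (intro mult_right_mono) auto
      moreover have "0 < y * z" using that assms by simp
      ultimately have "- 1 < y * z" "y * z < 1" using that by auto
      then have "((\<lambda>z. arcsin (y * z)) has_real_derivative inverse (sqrt (1 - (y * z)\<^sup>2)) * y) (at z)"
        by (intro DERIV_chain2[OF DERIV_arcsin]) (auto intro!: derivative_eq_intros)
      then show ?thesis
        by (simp add: has_real_derivative_iff_has_vector_derivative power_mult_distrib divide_inverse mult.commute)
    qed
  qed simp
  then show ?thesis by (simp add: has_integral_Icc_iff_Ioo)
qed

lemma has_integral_inverse_cube_sqrt:
  fixes y :: real
  assumes "0 \<le> y" "y < 1"
  shows "((\<lambda>z. 1 / ((1 - y\<^sup>2 * z\<^sup>2) * sqrt (1 - y\<^sup>2 * z\<^sup>2)))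
     has_integral 1 / sqrt (1 - y\<^sup>2)) {0<..<1}"
proof -
  have pos: "0 < 1 - y\<^sup>2 * z\<^sup>2" if "0 \<le> z" "z \<le> 1" for z
  proof -
    have "y\<^sup>2 * z\<^sup>2 \<le> y\<^sup>2 * 1" using that by (intro mult_left_mono power_le_one) auto
    also have "\<dots> < 1" using assms by (simp add: power_less_one_iff abs_square_less_1)
    finally show ?thesis by simp
  qed
  have "((\<lambda>z. 1 / ((1 - y\<^sup>2 * z\<^sup>2) * sqrt (1 - y\<^sup>2 * z\<^sup>2)))
     has_integral (1 / sqrt (1 - y\<^sup>2 * 1\<^sup>2) - 0 / sqrt (1 - y\<^sup>2 * 0\<^sup>2))) {0..1}"
  proof (rule fundamental_theorem_of_calculus_interior)
    show "continuous_on {0..1} (\<lambda>z. z / sqrt (1 - y\<^sup>2 * z\<^sup>2))"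
      using pos by (intro continuous_intros) (auto simp: less_imp_neq)
    show "((\<lambda>z. z / sqrt (1 - y\<^sup>2 * z\<^sup>2)) has_vector_derivative
      1 / ((1 - y\<^sup>2 * z\<^sup>2) * sqrt (1 - y\<^sup>2 * z\<^sup>2))) (at z)" if "z \<in> {0<..<1}" for z
    proof -
      define h where "h = 1 - y\<^sup>2 * z\<^sup>2"
      have h: "0 < h" using pos[of z] that by (simp add: h_def)
      have "((\<lambda>z. z / sqrt (1 - y\<^sup>2 * z\<^sup>2)) has_real_derivative
        (1 * sqrt h - z * (- (y\<^sup>2 * (2 * z)) * (inverse (sqrt h) / 2))) / (sqrt h * sqrt h)) (at z)"
        using h unfolding h_def by (auto intro!: derivative_eq_intros)
      also have "(1 * sqrt h - z * (- (y\<^sup>2 * (2 * z)) * (inverse (sqrt h) / 2))) / (sqrt h * sqrt h)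
        = (h + y\<^sup>2 * z\<^sup>2) / (h * sqrt h)"
        using h by (simp add: field_simps power2_eq_square)
      also have "h + y\<^sup>2 * z\<^sup>2 = 1" by (simp add: h_def)
      finally show ?thesis
        by (simp add: h_def has_real_derivative_iff_has_vector_derivative)
    qed
  qed simp
  then show ?thesis by (simp add: has_integral_Icc_iff_Ioo)
qed

text \<open>With \<open>t = 1 - z\<close>, the integrand is \<open>t / (s + t)\<close> divided by
  \<open>t * sqrt t\<close>: the shape of the integrand of \<open>dphi_fn\<close> when
  \<open>g_fn\<close> is comparable with \<open>t\<close>. The antiderivative is a multiple of
  \<open>arctan (sqrt (t / s))\<close>.\<close>

lemma has_integral_arctan_sqrt:
  fixes s :: real
  assumes "0 < s"
  shows "((\<lambda>z. 1 / ((s + (1 - z)) * sqrt (1 - z)))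
     has_integral 2 * arctan (1 / sqrt s) / sqrt s) {0<..<1}"
proof -
  define c where "c = 1 / sqrt s"
  have c: "c\<^sup>2 = 1 / s" "c > 0" using assms by (auto simp: c_def power_divide)
  let ?F = "\<lambda>z. - 2 * c * arctan (c * sqrt (1 - z))"
  have "((\<lambda>z. 1 / ((s + (1 - z)) * sqrt (1 - z))) has_integral ?F 1 - ?F 0) {0..1}"
  proof (rule fundamental_theorem_of_calculus_interior)
    show "continuous_on {0..1} ?F" by (intro continuous_intros)
    show "(?F has_vector_derivative 1 / ((s + (1 - z)) * sqrt (1 - z))) (at z)"
      if "z \<in> {0<..<1}" for z
    proof -
      have z: "0 < 1 - z" using that by simp
      have "(?F has_real_derivative
        - 2 * c * (inverse (1 + (c * sqrt (1 - z))\<^sup>2) * (c * (- 1 * (inverse (sqrt (1 - z)) / 2))))) (at z)"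
        using z by (auto intro!: derivative_eq_intros)
      also have "- 2 * c * (inverse (1 + (c * sqrt (1 - z))\<^sup>2) * (c * (- 1 * (inverse (sqrt (1 - z)) / 2))))
        = c\<^sup>2 * inverse (1 + c\<^sup>2 * (1 - z)) * inverse (sqrt (1 - z))"
        using z by (simp add: power_mult_distrib power2_eq_square)
      also have "c\<^sup>2 * inverse (1 + c\<^sup>2 * (1 - z)) = 1 / (s + (1 - z))"
        using z assms by (simp add: c inverse_eq_divide) (simp add: field_simps)
      finally show ?thesis by (simp add: has_real_derivative_iff_has_vector_derivative inverse_eq_divide)
    qed
  qed simp
  then show ?thesis by (simp add: has_integral_Icc_iff_Ioo c_def mult.commute)
qed

text \<open>The numerator is \<open>s\<close> times the derivative of \<open>z powr (1 / s)\<close>,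
  so a multiple of \<open>sqrt (1 - z powr (1 / s))\<close> is an antiderivative. The small value
  \<open>2 * s\<close> is the source of the relative error of order \<open>s / e\<close>.\<close>

lemma has_integral_powr_over_sqrt:
  fixes s :: real
  assumes "0 < s"
  shows "((\<lambda>z. z powr (1 / s - 1) / sqrt (1 - z powr (1 / s))) has_integral 2 * s) {0<..<1}"
proof -
  let ?F = "\<lambda>z. -2 * s * sqrt (1 - z powr (1 / s))"
  have "((\<lambda>z. z powr (1 / s - 1) / sqrt (1 - z powr (1 / s))) has_integral ?F 1 - ?F 0) {0..1}"
  proof (rule fundamental_theorem_of_calculus_interior)
    show "continuous_on {0..1} ?F"
      using assms by (intro continuous_intros continuous_on_powr') auto
    show "(?F has_vector_derivative z powr (1 / s - 1) / sqrt (1 - z powr (1 / s))) (at z)"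
      if "z \<in> {0<..<1}" for z
    proof -
      have "z powr (1 / s) < 1"
        using that assms powr_less_mono2[of "1/s" z 1] by simp
      then have "(?F has_real_derivative
        -2 * s * (- (1 / s * z powr (1 / s - 1)) * (inverse (sqrt (1 - z powr (1 / s))) / 2))) (at z)"
        using that assms by (auto intro!: derivative_eq_intros)
      also have "-2 * s * (- (1 / s * z powr (1 / s - 1)) * (inverse (sqrt (1 - z powr (1 / s))) / 2))
        = z powr (1 / s - 1) / sqrt (1 - z powr (1 / s))"
        using assms by (simp add: field_simps)
      finally show ?thesis by (simp add: has_real_derivative_iff_has_vector_derivative)
    qed
  qed simp
  then show ?thesis using assms by (simp add: has_integral_Icc_iff_Ioo)
qed

section \<open>Pointwise bounds for the integrand, and regularity of the deflection integral\<close>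

context
  fixes s :: real
  assumes s: "0 < s" "s < 1"
begin

text \<open>Write \<open>w = z powr (1 / s)\<close>. Each term of the convex combination dominates
  its share of \<open>1 - z\<close>, because \<open>w \<le> z\<close> and
  \<open>z\<^sup>2 \<le> z\<close>. The other three bounds drop the nonnegative terms
  \<open>(1 - y\<^sup>2) * w\<close>, \<open>y\<^sup>2 * w * (1 - z\<^sup>2)\<close> and
  \<open>y\<^sup>2 * (1 - z\<^sup>2)\<close>, respectively.\<close>

lemma
  assumes "0 \<le> y" "y \<le> 1" "0 < z" "z < 1"
  shows g_fn_ge: "1 - z \<le> g_fn s y z"
    and g_fn_le: "g_fn s y z \<le> 1 - y\<^sup>2 * z\<^sup>2"
    and g_fn_ge_mult: "(1 - y\<^sup>2 * z\<^sup>2) * (1 - z powr (1 / s)) \<le> g_fn s y z"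
    and g_fn_ge_const: "(1 - y\<^sup>2) * (1 - z powr (1 / s)) \<le> g_fn s y z"
proof -
  define w where "w = z powr (1 / s)"
  have w: "0 < w" "w \<le> z" using powr_inverse_bounds[OF s, of z] assms by (auto simp: w_def)
  have y2: "y\<^sup>2 \<le> 1" "z\<^sup>2 \<le> 1" "z\<^sup>2 \<le> z"
    using assms by (auto simp: power_le_one power2_eq_square mult_left_le mult_le_one)
  have g: "g_fn s y z = (1 - y\<^sup>2) * (1 - w) + y\<^sup>2 * (1 - z\<^sup>2)"
    by (simp add: g_fn_convex w_def)
  have "(1 - y\<^sup>2) * (1 - z) \<le> (1 - y\<^sup>2) * (1 - w)" "y\<^sup>2 * (1 - z) \<le> y\<^sup>2 * (1 - z\<^sup>2)"
    using y2 w by (auto intro!: mult_left_mono)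
  then show "1 - z \<le> g_fn s y z" unfolding g by (simp add: algebra_simps)
  have "0 \<le> (1 - y\<^sup>2) * w" using y2 w by simp
  then show "g_fn s y z \<le> 1 - y\<^sup>2 * z\<^sup>2" unfolding g by (simp add: algebra_simps)
  have "0 \<le> y\<^sup>2 * w * (1 - z\<^sup>2)" using y2 w by simp
  then show "(1 - y\<^sup>2 * z\<^sup>2) * (1 - z powr (1 / s)) \<le> g_fn s y z"
    unfolding g w_def[symmetric] by (simp add: algebra_simps)
  have "0 \<le> y\<^sup>2 * (1 - z\<^sup>2)" using y2 by simp
  then show "(1 - y\<^sup>2) * (1 - z powr (1 / s)) \<le> g_fn s y z"
    unfolding g w_def[symmetric] by simp
qed

lemma g_fn_pos:
  assumes "0 \<le> y" "y \<le> 1" "0 < z" "z < 1"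
  shows "0 < g_fn s y z"
  using g_fn_ge[OF assms] assms by simp

lemma phi_fn_eq: "phi_fn s y = integral {0<..<1} (\<lambda>z. y / sqrt (g_fn s y z))"
proof -
  have "integral {0..1} (\<lambda>z. 1 / sqrt (g_fn s y z)) = integral {0<..<1} (\<lambda>z. 1 / sqrt (g_fn s y z))"
    unfolding integral_def integrable_on_def has_integral_Icc_iff_Ioo by simp
  moreover have "integral {0<..<1} (\<lambda>z. y * (1 / sqrt (g_fn s y z))) =
      y * integral {0<..<1} (\<lambda>z. 1 / sqrt (g_fn s y z))"
    by (rule Henstock_Kurzweil_Integration.integral_mult_right)
  ultimately show ?thesis by (simp add: phi_fn_def)
qed

lemma inverse_sqrt_g_fn_le:
  assumes "0 \<le> y" "y \<le> 1" "0 < z" "z < 1"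
  shows "1 / sqrt (g_fn s y z) \<le> 1 / sqrt (1 - z)"
  using assms g_fn_ge[OF assms] by (intro divide_left_mono) (auto intro!: mult_pos_pos)

lemma phi_integrand_bound:
  assumes "0 \<le> y" "y \<le> 1" "0 < z" "z < 1"
  shows "\<bar>y / sqrt (g_fn s y z)\<bar> \<le> 1 / sqrt (1 - z)"
proof -
  have "y * (1 / sqrt (g_fn s y z)) \<le> 1 * (1 / sqrt (1 - z))"
    using assms g_fn_pos[OF assms] inverse_sqrt_g_fn_le[OF assms] by (intro mult_mono) auto
  then show ?thesis using assms g_fn_pos[OF assms] by simp
qed

text \<open>The factor \<open>(1 - w) / g\<close> is at most \<open>1 / (1 - y\<^sup>2)\<close> and
  the factor \<open>1 / sqrt g\<close> at most \<open>1 / sqrt (1 - z)\<close>. The constant depends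
  only on the upper limit \<open>c\<close> for \<open>y\<close>, as domination requires.\<close>

lemma dphi_integrand_bound:
  assumes "0 \<le> y" "y \<le> c" "c < 1" "0 < z" "z < 1"
  shows "\<bar>(1 - z powr (1 / s)) / (g_fn s y z * sqrt (g_fn s y z))\<bar>
    \<le> (1 / (1 - c\<^sup>2)) / sqrt (1 - z)"
proof -
  have g: "0 < g_fn s y z" using assms g_fn_pos by simp
  have w: "0 < 1 - z powr (1 / s)"
    using powr_inverse_bounds[OF s, of z] assms by auto
  have c: "0 < 1 - c\<^sup>2" "1 - c\<^sup>2 \<le> 1 - y\<^sup>2"
    using assms by (auto simp: abs_square_less_1 power_mono)
  have "(1 - c\<^sup>2) * (1 - z powr (1 / s)) \<le> (1 - y\<^sup>2) * (1 - z powr (1 / s))"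
    using w c by (intro mult_right_mono) auto
  also have "\<dots> \<le> g_fn s y z" using assms by (intro g_fn_ge_const) auto
  finally have "(1 - z powr (1 / s)) / g_fn s y z \<le> 1 / (1 - c\<^sup>2)"
    using c g by (simp add: field_simps)
  then have "(1 - z powr (1 / s)) / g_fn s y z * (1 / sqrt (g_fn s y z)) \<le> 1 / (1 - c\<^sup>2) * (1 / sqrt (1 - z))"
    using assms inverse_sqrt_g_fn_le[of y z] c g by (intro mult_mono) auto
  then show ?thesis using g w by (simp add: field_simps)
qed

lemma phi_integrand_integrable:
  assumes "0 \<le> y" "y \<le> 1"
  shows "(\<lambda>z. y / sqrt (g_fn s y z)) integrable_on {0<..<1}"
  using assms by (intro integrable_on_inverse_sqrt_bound[where C = 1] phi_integrand_bound) measurable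

lemma dphi_integrand_integrable:
  assumes "0 \<le> y" "y < 1"
  shows "(\<lambda>z. (1 - z powr (1 / s)) / (g_fn s y z * sqrt (g_fn s y z))) integrable_on {0<..<1}"
  using assms 
  by (intro integrable_on_inverse_sqrt_bound[where C = "1 / (1 - y\<^sup>2)"] dphi_integrand_bound) auto

lemma continuous_on_g_fn: "continuous_on S (\<lambda>y. g_fn s y z)"
  unfolding g_fn_def by (intro continuous_intros)

text \<open>This is \<open>phi_fn s y / y\<close>, extended continuously to \<open>y = 0\<close>; it
  resolves the quotient \<open>0 / 0\<close> in the limit at \<open>\<theta> = pi\<close>.\<close>

lemma continuous_on_mean_inverse_sqrt_g:
  "continuous_on {0..1} (\<lambda>y. integral {0<..<1} (\<lambda>z. 1 / sqrt (g_fn s y z)))"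
proof (rule continuous_on_integral_dominated[where C = 1])
  show "(\<lambda>z. 1 / sqrt (g_fn s y z)) \<in> borel_measurable borel" for y by measurable
  show "\<bar>1 / sqrt (g_fn s y z)\<bar> \<le> 1 / sqrt (1 - z)" if "y \<in> {0..1}" "0 < z" "z < 1" for y z
    using inverse_sqrt_g_fn_le[of y z] g_fn_pos[of y z] that by simp
  show "continuous_on {0..1} (\<lambda>y. 1 / sqrt (g_fn s y z))" if "0 < z" "z < 1" for z
    using that g_fn_pos[of _ z]
    by (intro continuous_intros continuous_on_g_fn) (force simp: less_le)
qed

lemma phi_fn_eq_mult: "phi_fn s y = y * integral {0<..<1} (\<lambda>z. 1 / sqrt (g_fn s y z))"
  unfolding phi_fn_eq by (simp flip: Henstock_Kurzweil_Integration.integral_mult_right)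

lemma continuous_on_phi_fn: "continuous_on {0..1} (phi_fn s)"
  unfolding phi_fn_eq_mult[abs_def]
  by (intro continuous_intros continuous_on_mean_inverse_sqrt_g)

lemma continuous_on_dphi_fn:
  assumes "c < 1"
  shows "continuous_on {0..c} (dphi_fn s)"
  unfolding dphi_fn_def[abs_def]
proof (rule continuous_on_integral_dominated)
  fix y assume y: "y \<in> {0..c}"
  show "(\<lambda>z. (1 - z powr (1 / s)) / (g_fn s y z * sqrt (g_fn s y z))) \<in> borel_measurable borel"
    by measurable
  fix z :: real assume "0 < z" "z < 1"
  then show "\<bar>(1 - z powr (1 / s)) / (g_fn s y z * sqrt (g_fn s y z))\<bar> \<le> (1 / (1 - c\<^sup>2)) / sqrt (1 - z)"
    using y assms by (intro dphi_integrand_bound) auto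
next
  fix z :: real assume z: "0 < z" "z < 1"
  have "g_fn s y z > 0" if "y \<in> {0..c}" for y
    using that assms z by (intro g_fn_pos) auto
  then show "continuous_on {0..c} (\<lambda>y. (1 - z powr (1 / s)) / (g_fn s y z * sqrt (g_fn s y z)))"
    by (intro continuous_intros continuous_on_g_fn) (force simp: less_le)
qed

lemma has_field_derivative_phi_fn:
  assumes "0 < a" "a < 1"
  shows "(phi_fn s has_real_derivative dphi_fn s a) (at a)"
proof -
  \<comment> \<open>The room between \<open>a\<close> and 1 gives one majorant of the derivative for
    all \<open>y\<close> in \<open>{0<..<c}\<close>.\<close>
  obtain c where c: "a < c" "c < 1" using assms dense by blast
  show ?thesis
    unfolding phi_fn_eq[abs_def] dphi_fn_def
  proof (rule has_field_derivative_integral_dominated)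
    show "a \<in> {0<..<c}" using assms c by simp
    show "(\<lambda>z. y / sqrt (g_fn s y z)) integrable_on {0<..<1}" if "y \<in> {0<..<c}" for y
      using that c by (intro phi_integrand_integrable) auto
    show "(\<lambda>z. y / sqrt (g_fn s y z)) \<in> borel_measurable borel" for y by measurable
    show "(\<lambda>z. (1 - z powr (1 / s)) / (g_fn s a z * sqrt (g_fn s a z))) \<in> borel_measurable borel"
      by measurable
    fix y z :: real assume y: "y \<in> {0<..<c}" and z: "0 < z" "z < 1"
    then show "\<bar>(1 - z powr (1 / s)) / (g_fn s y z * sqrt (g_fn s y z))\<bar>
        \<le> (1 / (1 - c\<^sup>2)) / sqrt (1 - z)"
      using c by (intro dphi_integrand_bound) auto
    define g where "g = g_fn s y z"
    have g: "0 < g" using y c z by (auto simp: g_def intro!: g_fn_pos)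
    have dg: "((\<lambda>y. g_fn s y z) has_real_derivative - (2 * y * (z\<^sup>2 - z powr (1 / s)))) (at y)"
      unfolding g_fn_def by (auto intro!: derivative_eq_intros)
    have "((\<lambda>y. y / sqrt (g_fn s y z)) has_real_derivative
        (1 * sqrt g - y * (- (2 * y * (z\<^sup>2 - z powr (1 / s))) * (inverse (sqrt g) / 2))) / (sqrt g * sqrt g)) (at y)"
      using g unfolding g_def by (auto intro!: derivative_eq_intros dg)
    also have "(1 * sqrt g - y * (- (2 * y * (z\<^sup>2 - z powr (1 / s))) * (inverse (sqrt g) / 2))) / (sqrt g * sqrt g)
        = (g + y\<^sup>2 * (z\<^sup>2 - z powr (1 / s))) / (g * sqrt g)"
      using g by (simp add: field_simps power2_eq_square)
    \<comment> \<open>By the definition of \<open>g_fn\<close> the numerator no longer depends on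
      \<open>y\<close>.\<close>
    also have "g + y\<^sup>2 * (z\<^sup>2 - z powr (1 / s)) = 1 - z powr (1 / s)"
      by (simp add: g_def g_fn_def)
    finally show "((\<lambda>y. y / sqrt (g_fn s y z)) has_real_derivative
        (1 - z powr (1 / s)) / (g_fn s y z * sqrt (g_fn s y z))) (at y)"
      by (simp add: g_def)
  qed
qed

end

subsection \<open>Estimates for the deflection integral and its inverse\<close>

text \<open>A number between 0 and 1 is at most its square root; here the number is
  \<open>1 - w\<close>.\<close>

lemma one_le_sqrt_add:
  fixes w :: real
  assumes "0 \<le> w" "w \<le> 1"
  shows "1 \<le> sqrt (1 - w) + w"
  using real_le_rsqrt[of "1 - w" "1 - w"] assms
  by (simp add: power2_eq_square mult_left_le)

context
  fixes s :: real
  assumes s: "0 < s" "s < 1"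
begin

lemma has_integral_dphi_fn:
  assumes "0 \<le> y" "y < 1"
  shows "((\<lambda>z. (1 - z powr (1 / s)) / (g_fn s y z * sqrt (g_fn s y z)))
    has_integral dphi_fn s y) {0<..<1}"
  unfolding dphi_fn_def using dphi_integrand_integrable[OF s assms] by blast

lemma has_integral_phi_fn:
  assumes "0 \<le> y" "y \<le> 1"
  shows "((\<lambda>z. y / sqrt (g_fn s y z)) has_integral phi_fn s y) {0<..<1}"
  unfolding phi_fn_eq[OF s] using phi_integrand_integrable[OF s assms] by blast

text \<open>With \<open>t = 1 - z\<close> and \<open>w = z powr (1 / s)\<close>, the integrand is
  bounded through \<open>g \<ge> t\<close> and \<open>1 - w \<le> 2 * t / (s + t)\<close>. The bound
  is uniform in \<open>y\<close>, as the mean value argument up to \<open>y = 1\<close>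
  requires.\<close>

lemma dphi_fn_le_arctan:
  assumes "0 \<le> y" "y < 1"
  shows "dphi_fn s y \<le> 4 * (arctan (1 / sqrt s) / sqrt s)"
proof -
  have "((\<lambda>z. 2 * (1 / ((s + (1 - z)) * sqrt (1 - z))))
     has_integral 2 * (2 * arctan (1 / sqrt s) / sqrt s)) {0<..<1}"
    by (intro has_integral_mult_right has_integral_arctan_sqrt s)
  then have "dphi_fn s y \<le> 2 * (2 * arctan (1 / sqrt s) / sqrt s)"
  proof (rule has_integral_le[OF has_integral_dphi_fn[OF assms]])
    fix z :: real assume z: "z \<in> {0<..<1}"
    define t where "t = 1 - z"
    have t: "0 < t" using z by (simp add: t_def)
    have g: "t \<le> g_fn s y z" using g_fn_ge[OF s, of y z] assms z by (simp add: t_def)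
    have w: "0 < z powr (1 / s)" "z powr (1 / s) \<le> z" "1 - z powr (1 / s) \<le> t / s"
      using powr_inverse_bounds[OF s, of z] z by (auto simp: t_def)
    have "1 - z powr (1 / s) \<le> 2 * t / (s + t)"
    \<comment> \<open>For \<open>t \<le> s\<close> the linear bound \<open>t / s\<close> suffices,
      for larger \<open>t\<close> the trivial bound 1.\<close>
    proof (cases "t \<le> s")
      case True
      have "t / s \<le> 2 * t / (s + t)" using True t s by (simp add: field_simps)
      then show ?thesis using w by simp
    next
      case False
      have "1 \<le> 2 * t / (s + t)" using False t s by (simp add: field_simps)
      then show ?thesis using w(1) by linarith
    qed
    then have "(1 - z powr (1 / s)) / (g_fn s y z * sqrt (g_fn s y z)) \<le> 2 * t / (s + t) / (t * sqrt t)"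
      using g t w z s by (intro frac_le mult_mono) auto
    also have "\<dots> = 2 * (1 / ((s + t) * sqrt t))" using t by simp
    finally show "(1 - z powr (1 / s)) / (g_fn s y z * sqrt (g_fn s y z))
        \<le> 2 * (1 / ((s + (1 - z)) * sqrt (1 - z)))"
      by (simp add: t_def)
  qed
  then show ?thesis by simp
qed

text \<open>Here \<open>g \<le> C * t\<close>, since \<open>1 - w \<le> t / s\<close> and
  \<open>1 - z\<^sup>2 \<le> 2 * t\<close>, while \<open>1 - w \<ge> t / (s + t)\<close>. If
  \<open>1 - y\<^sup>2 \<le> 4 * s\<close>, then \<open>C \<le> 6\<close> and the bound matches
  \<open>dphi_fn_le_arctan\<close> up to a constant factor.\<close>

lemma dphi_fn_ge_arctan:
  assumes "0 \<le> y" "y < 1"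
  defines "C \<equiv> 2 + (1 - y\<^sup>2) / s"
  shows "2 * (arctan (1 / sqrt s) / sqrt s) / (C * sqrt C) \<le> dphi_fn s y"
proof -
  have y2: "0 < 1 - y\<^sup>2" "1 - y\<^sup>2 \<le> 1" using assms by (auto simp: abs_square_less_1)
  have C: "0 < C" using y2 s by (simp add: C_def add_pos_pos)
  have "((\<lambda>z. 1 / (C * sqrt C) * (1 / ((s + (1 - z)) * sqrt (1 - z))))
     has_integral 1 / (C * sqrt C) * (2 * arctan (1 / sqrt s) / sqrt s)) {0<..<1}"
    by (intro has_integral_mult_right has_integral_arctan_sqrt s)
  then have "1 / (C * sqrt C) * (2 * arctan (1 / sqrt s) / sqrt s) \<le> dphi_fn s y"
  proof (rule has_integral_le[OF _ has_integral_dphi_fn[OF assms(1,2)]])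
    fix z :: real assume z: "z \<in> {0<..<1}"
    define t where "t = 1 - z"
    have t: "0 < t" using z by (simp add: t_def)
    have w: "t / (s + t) \<le> 1 - z powr (1 / s)" "1 - z powr (1 / s) \<le> t / s"
      using powr_inverse_bounds[OF s, of z] z by (auto simp: t_def)
    have z2: "1 - z\<^sup>2 \<le> 2 * t" "0 \<le> 1 - z\<^sup>2"
      using zero_le_power2[of "1 - z"] z
      by (simp_all add: power2_diff t_def power_le_one)
    have "g_fn s y z \<le> (1 - y\<^sup>2) * (t / s) + 1 * (2 * t)"
      unfolding g_fn_convex using w y2 z2 by (intro add_mono mult_left_mono mult_mono) auto
    then have gle: "g_fn s y z \<le> C * t" by (simp add: C_def algebra_simps add_divide_distrib diff_divide_distrib)
    have g: "0 < g_fn s y z" using g_fn_pos[OF s] assms z by simp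
    have "t / (s + t) / (C * t * sqrt (C * t)) \<le> (1 - z powr (1 / s)) / (g_fn s y z * sqrt (g_fn s y z))"
    proof (rule frac_le)
      show "0 \<le> 1 - z powr (1 / s)" using powr_inverse_le[OF s, of z] z by simp
      show "g_fn s y z * sqrt (g_fn s y z) \<le> C * t * sqrt (C * t)"
        using g gle by (intro mult_mono) auto
    qed (use g w in auto)
    moreover have "t / (s + t) / (C * t * sqrt (C * t)) = 1 / (C * sqrt C) * (1 / ((s + t) * sqrt t))"
      using t C s by (simp add: real_sqrt_mult)
    ultimately show "1 / (C * sqrt C) * (1 / ((s + (1 - z)) * sqrt (1 - z)))
        \<le> (1 - z powr (1 / s)) / (g_fn s y z * sqrt (g_fn s y z))"
      by (simp add: t_def)
  qed
  then show ?thesis by (simp add: mult_ac)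
qed

lemma dphi_fn_pos:
  assumes "0 \<le> y" "y < 1"
  shows "0 < dphi_fn s y"
proof -
  have "0 < 2 + (1 - y\<^sup>2) / s"
    using assms s by (intro add_pos_nonneg divide_nonneg_pos) (auto simp: power_le_one)
  then have "0 < 2 * (arctan (1 / sqrt s) / sqrt s) / ((2 + (1 - y\<^sup>2) / s) * sqrt (2 + (1 - y\<^sup>2) / s))"
    using s by simp
  with dphi_fn_ge_arctan[OF assms] show ?thesis by linarith
qed

text \<open>The integrand is bounded through \<open>1 - w \<le> t / s\<close> and
  \<open>g \<ge> t\<close>. For \<open>s \<ge> 1 / 2\<close> this is smaller than the arctangent
  bound.\<close>

lemma dphi_fn_le_inverse:
  assumes "0 \<le> y" "y < 1"
  shows "dphi_fn s y \<le> 2 / s"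
proof -
  have "((\<lambda>z. 1 / s * (1 / sqrt (1 - z))) has_integral 1 / s * 2) {0<..<1}"
    by (intro has_integral_mult_right has_integral_inverse_sqrt)
  then have "dphi_fn s y \<le> 1 / s * 2"
  proof (rule has_integral_le[OF has_integral_dphi_fn[OF assms]])
    fix z :: real assume z: "z \<in> {0<..<1}"
    define t where "t = 1 - z"
    have t: "0 < t" using z by (simp add: t_def)
    have g: "t \<le> g_fn s y z" using g_fn_ge[OF s, of y z] assms z by (simp add: t_def)
    have w: "1 - z powr (1 / s) \<le> t / s"
      using powr_inverse_bounds[OF s, of z] z by (auto simp: t_def)
    then have "(1 - z powr (1 / s)) / (g_fn s y z * sqrt (g_fn s y z)) \<le> t / s / (t * sqrt t)"
      using g t w z s by (intro frac_le mult_mono) auto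
    then show "(1 - z powr (1 / s)) / (g_fn s y z * sqrt (g_fn s y z)) \<le> 1 / s * (1 / sqrt (1 - z))"
      using t by (simp add: t_def)
  qed
  then show ?thesis by simp
qed

text \<open>For \<open>s \<ge> 1 / 2\<close> both \<open>1 - w\<close> and
  \<open>1 - z\<^sup>2\<close> are at most \<open>2 * t\<close>, hence so is their convex
  combination \<open>g\<close>; the numerator is at least \<open>t\<close>.\<close>

lemma dphi_fn_ge_half:
  assumes "0 \<le> y" "y < 1" "1 / 2 \<le> s"
  shows "1 / sqrt 2 \<le> dphi_fn s y"
proof -
  have y2: "0 < 1 - y\<^sup>2" using assms by (auto simp: abs_square_less_1)
  have "((\<lambda>z. 1 / (2 * sqrt 2) * (1 / sqrt (1 - z))) has_integral 1 / (2 * sqrt 2) * 2) {0<..<1}"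
    by (intro has_integral_mult_right has_integral_inverse_sqrt)
  then have "1 / (2 * sqrt 2) * 2 \<le> dphi_fn s y"
  proof (rule has_integral_le[OF _ has_integral_dphi_fn[OF assms(1,2)]])
    fix z :: real assume z: "z \<in> {0<..<1}"
    define t where "t = 1 - z"
    have t: "0 < t" using z by (simp add: t_def)
    have w: "t \<le> 1 - z powr (1 / s)" "1 - z powr (1 / s) \<le> t / s"
      using powr_inverse_bounds[OF s, of z] z by (auto simp: t_def)
    have z2: "1 - z\<^sup>2 \<le> 2 * t" "0 \<le> 1 - z\<^sup>2"
      using zero_le_power2[of "1 - z"] z
      by (simp_all add: power2_diff t_def power_le_one)
    have "t / s \<le> 2 * t" using t s assms by (simp add: field_simps)
    then have "g_fn s y z \<le> (1 - y\<^sup>2) * (2 * t) + y\<^sup>2 * (2 * t)"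
      unfolding g_fn_convex using w y2 z2 by (intro add_mono mult_left_mono) auto
    then have gle: "g_fn s y z \<le> 2 * t" by (simp add: algebra_simps)
    have g: "0 < g_fn s y z" using g_fn_pos[OF s] assms z by simp
    have "t / (2 * t * sqrt (2 * t)) \<le> (1 - z powr (1 / s)) / (g_fn s y z * sqrt (g_fn s y z))"
      using g gle t w by (intro frac_le mult_mono) auto
    moreover have "t / (2 * t * sqrt (2 * t)) = 1 / (2 * sqrt 2) * (1 / sqrt t)"
      using t by (simp add: real_sqrt_mult)
    ultimately show "1 / (2 * sqrt 2) * (1 / sqrt (1 - z))
        \<le> (1 - z powr (1 / s)) / (g_fn s y z * sqrt (g_fn s y z))"
      by (simp add: t_def)
  qed
  then show ?thesis by simp
qed

text \<open>\<open>\<kappa>\<close> is the kernel with integral \<open>2 * s\<close>. It bounds both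
  errors of replacing \<open>w = z powr (1 / s)\<close> by 0: the excess of
  \<open>1 / sqrt (1 - w)\<close> over 1, and \<open>w\<close> itself.\<close>

lemma kernel_bounds:
  fixes z :: real
  assumes "0 < z" "z < 1"
  defines "\<kappa> \<equiv> z powr (1 / s - 1) / sqrt (1 - z powr (1 / s))"
  shows "1 / sqrt (1 - z powr (1 / s)) \<le> 1 + \<kappa>" and "z powr (1 / s) \<le> \<kappa>"
proof -
  define w where "w = z powr (1 / s)"
  have w: "0 < w" "w < 1" using powr_inverse_bounds[OF s, of z] assms by (auto simp: w_def)
  then have sq: "0 < sqrt (1 - w)" "sqrt (1 - w) \<le> 1" by auto
  \<comment> \<open>Lowering the exponent by 1 enlarges a power of \<open>z < 1\<close>, and the
    larger numerator has an explicit antiderivative.\<close>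
  have wle: "w \<le> z powr (1 / s - 1)"
    unfolding w_def using assms by (intro powr_mono') auto
  have "1 \<le> sqrt (1 - w) + z powr (1 / s - 1)"
    using one_le_sqrt_add[of w] w wle by simp
  then show "1 / sqrt (1 - z powr (1 / s)) \<le> 1 + \<kappa>"
    unfolding \<kappa>_def w_def[symmetric] using sq by (simp add: field_simps)
  have "w * sqrt (1 - w) \<le> w * 1" using w sq by (intro mult_left_mono) auto
  then show "z powr (1 / s) \<le> \<kappa>"
    unfolding \<kappa>_def w_def[symmetric] using sq wle by (simp add: field_simps)
qed

lemma phi_fn_ge_arcsin:
  assumes "0 < y" "y \<le> 1"
  shows "arcsin y \<le> phi_fn s y"
proof (rule has_integral_le[OF has_integral_arcsin[OF assms] has_integral_phi_fn])
  fix z :: real assume z: "z \<in> {0<..<1}"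
  have g: "0 < g_fn s y z" "g_fn s y z \<le> 1 - y\<^sup>2 * z\<^sup>2"
    using g_fn_pos[OF s] g_fn_le[OF s] assms z by simp_all
  then show "y / sqrt (1 - y\<^sup>2 * z\<^sup>2) \<le> y / sqrt (g_fn s y z)"
    using assms by (intro divide_left_mono) auto
qed (use assms in auto)

text \<open>With \<open>h = 1 - y\<^sup>2 * z\<^sup>2\<close>, the bound
  \<open>g \<ge> h * (1 - w)\<close> splits off the factor
  \<open>1 / sqrt (1 - w) \<le> 1 + \<kappa>\<close>. The 1 yields the arcsine; in the error term
  \<open>h\<close> is replaced by its lower bound \<open>1 - y\<^sup>2\<close>, and
  \<open>\<kappa>\<close> integrates to \<open>2 * s\<close>.\<close>

lemma phi_fn_le_arcsin:
  assumes "0 < y" "y < 1"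
  shows "phi_fn s y \<le> arcsin y + 2 * s * y / sqrt (1 - y\<^sup>2)"
proof -
  define e where "e = 1 - y\<^sup>2"
  have e: "0 < e" using assms by (auto simp: abs_square_less_1 e_def)
  have "((\<lambda>z. y / sqrt (1 - y\<^sup>2 * z\<^sup>2) + y / sqrt e * (z powr (1 / s - 1) / sqrt (1 - z powr (1 / s))))
    has_integral arcsin y + y / sqrt e * (2 * s)) {0<..<1}"
    using assms s by (intro has_integral_add has_integral_mult_right has_integral_arcsin has_integral_powr_over_sqrt) auto
  then have "phi_fn s y \<le> arcsin y + y / sqrt e * (2 * s)"
  proof (rule has_integral_le[OF has_integral_phi_fn, rotated -2])
    fix z :: real assume z: "z \<in> {0<..<1}"
    define h where "h = 1 - y\<^sup>2 * z\<^sup>2"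
    define w where "w = z powr (1 / s)"
    define \<kappa> where "\<kappa> = z powr (1 / s - 1) / sqrt (1 - w)"
    have w: "0 < w" "w < 1" using powr_inverse_bounds[OF s, of z] z by (auto simp: w_def)
    have k: "1 / sqrt (1 - w) \<le> 1 + \<kappa>" "0 \<le> \<kappa>"
      using kernel_bounds[of z] z w by (auto simp: w_def \<kappa>_def)
    have "e \<le> h" using z by (simp add: e_def h_def mult_left_le power_le_one)
    have "h * (1 - w) \<le> g_fn s y z"
      using g_fn_ge_mult[OF s, of y z] assms z by (simp add: h_def w_def)
    then have "y / sqrt (g_fn s y z) \<le> y / sqrt (h * (1 - w))"
      using assms w e \<open>e \<le> h\<close> g_fn_pos[OF s, of y z] z by (intro divide_left_mono) auto
    also have "\<dots> = y / sqrt h * (1 / sqrt (1 - w))" by (simp add: real_sqrt_mult)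
    also have "\<dots> \<le> y / sqrt h * (1 + \<kappa>)"
      using k e \<open>e \<le> h\<close> assms by (intro mult_left_mono) auto
    also have "\<dots> = y / sqrt h + y / sqrt h * \<kappa>" by (simp add: ring_distribs add_divide_distrib)
    also have "\<dots> \<le> y / sqrt h + y / sqrt e * \<kappa>"
      using k e \<open>e \<le> h\<close> assms by (intro add_left_mono mult_right_mono divide_left_mono) auto
    finally show "y / sqrt (g_fn s y z) \<le> y / sqrt (1 - y\<^sup>2 * z\<^sup>2) +
        y / sqrt e * (z powr (1 / s - 1) / sqrt (1 - z powr (1 / s)))"
      by (simp add: h_def \<kappa>_def w_def)
  qed (use assms in auto)
  then show ?thesis by (simp add: e_def mult_ac)
qed

text \<open>The same comparison with exponent 3/2. In the upper bound the numerator cancels one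
  factor \<open>1 - w\<close>, which again leaves
  \<open>1 / sqrt (1 - w) \<le> 1 + \<kappa>\<close>; the lower bound uses \<open>g \<le> h\<close>
  and \<open>w \<le> \<kappa>\<close>.\<close>

lemma dphi_fn_near_inverse_sqrt:
  assumes "0 \<le> y" "y < 1"
  defines "e \<equiv> 1 - y\<^sup>2"
  shows "dphi_fn s y \<le> 1 / sqrt e + 2 * s / (e * sqrt e)"
    and "1 / sqrt e - 2 * s / (e * sqrt e) \<le> dphi_fn s y"
proof -
  let ?K = "\<lambda>z. z powr (1 / s - 1) / sqrt (1 - z powr (1 / s))"
  let ?J = "\<lambda>z. 1 / ((1 - y\<^sup>2 * z\<^sup>2) * sqrt (1 - y\<^sup>2 * z\<^sup>2))"
  let ?L = "\<lambda>z. (1 - z powr (1 / s)) / (g_fn s y z * sqrt (g_fn s y z))"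
  have e: "0 < e" using assms by (auto simp: abs_square_less_1)
  have J: "(?J has_integral 1 / sqrt e) {0<..<1}"
    unfolding e_def using assms by (intro has_integral_inverse_cube_sqrt)
  have K: "((\<lambda>z. 1 / (e * sqrt e) * ?K z) has_integral 1 / (e * sqrt e) * (2 * s)) {0<..<1}"
    using s by (intro has_integral_mult_right has_integral_powr_over_sqrt)
  have *: "?L z \<le> ?J z + 1 / (e * sqrt e) * ?K z \<and> ?J z - 1 / (e * sqrt e) * ?K z \<le> ?L z"
    if z: "z \<in> {0<..<1}" for z
  proof
    define h where "h = 1 - y\<^sup>2 * z\<^sup>2"
    define w where "w = z powr (1 / s)"
    define \<kappa> where "\<kappa> = z powr (1 / s - 1) / sqrt (1 - w)"
    define g where "g = g_fn s y z"
    have w: "0 < w" "w < 1" using powr_inverse_bounds[OF s, of z] z by (auto simp: w_def)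
    have k: "1 / sqrt (1 - w) \<le> 1 + \<kappa>" "0 \<le> \<kappa>" "w \<le> \<kappa>"
      using kernel_bounds[of z] z w by (auto simp: w_def \<kappa>_def)
    have eh: "e \<le> h" using z by (simp add: e_def h_def mult_left_le power_le_one)
    have h: "0 < h" using eh e by simp
    have g: "h * (1 - w) \<le> g" "g \<le> h" "0 < g"
      using g_fn_ge_mult[OF s, of y z] g_fn_le[OF s, of y z] g_fn_pos[OF s, of y z] assms z
      by (simp_all add: h_def w_def g_def)
    have q: "1 / (h * sqrt h) \<le> 1 / (e * sqrt e)"
      using e eh h by (intro divide_left_mono mult_mono) auto
    have "(1 - w) / (g * sqrt g) \<le> (1 - w) / (h * (1 - w) * sqrt (h * (1 - w)))"
      using g w h by (intro divide_left_mono mult_mono) auto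
    also have "\<dots> = 1 / (h * sqrt h) * (1 / sqrt (1 - w))"
      using w h by (simp add: real_sqrt_mult)
    also have "\<dots> \<le> 1 / (h * sqrt h) * (1 + \<kappa>)"
      using k h by (intro mult_left_mono) auto
    also have "\<dots> = 1 / (h * sqrt h) + 1 / (h * sqrt h) * \<kappa>" by (simp add: ring_distribs add_divide_distrib)
    also have "\<dots> \<le> 1 / (h * sqrt h) + 1 / (e * sqrt e) * \<kappa>"
      using k q by (intro add_left_mono mult_right_mono) auto
    finally show "?L z \<le> ?J z + 1 / (e * sqrt e) * ?K z"
      by (simp add: h_def \<kappa>_def w_def g_def)
    have "1 / (h * sqrt h) * w \<le> 1 / (e * sqrt e) * \<kappa>"
      using k q w e by (intro mult_mono) auto
    then have "1 / (h * sqrt h) - 1 / (e * sqrt e) * \<kappa> \<le> 1 / (h * sqrt h) - 1 / (h * sqrt h) * w"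
      by simp
    also have "\<dots> = (1 - w) / (h * sqrt h)" by (simp add: diff_divide_distrib)
    also have "\<dots> \<le> (1 - w) / (g * sqrt g)"
      using g w h by (intro divide_left_mono mult_mono) auto
    finally show "?J z - 1 / (e * sqrt e) * ?K z \<le> ?L z"
      by (simp add: h_def \<kappa>_def w_def g_def)
  qed
  have "dphi_fn s y \<le> 1 / sqrt e + 1 / (e * sqrt e) * (2 * s)"
    by (rule has_integral_le[OF has_integral_dphi_fn[OF assms(1,2)] has_integral_add[OF J K]]) (use * in blast)
  then show "dphi_fn s y \<le> 1 / sqrt e + 2 * s / (e * sqrt e)" by simp
  have "1 / sqrt e - 1 / (e * sqrt e) * (2 * s) \<le> dphi_fn s y"
    by (rule has_integral_le[OF has_integral_diff[OF J K] has_integral_dphi_fn[OF assms(1,2)]]) (use * in blast)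
  then show "1 / sqrt e - 2 * s / (e * sqrt e) \<le> dphi_fn s y" by simp
qed

section \<open>The deflection integral as a bijection, and its inverse\<close>

lemma phi_fn_0: "phi_fn s 0 = 0"
  by (simp add: phi_fn_def)

text \<open>At \<open>y = 1\<close> the terms with \<open>z powr (1 / s)\<close> cancel, so the
  value is that of the arcsine integral for every \<open>s\<close>.\<close>

lemma phi_fn_1: "phi_fn s 1 = pi / 2"
proof -
  have "((\<lambda>z. 1 / sqrt (1 - z\<^sup>2)) has_integral phi_fn s 1) {0<..<1}"
    using has_integral_phi_fn[of 1] by (simp add: g_fn_def)
  moreover have "((\<lambda>z. 1 / sqrt (1 - z\<^sup>2)) has_integral pi / 2) {0<..<1}"
    using has_integral_arcsin[of 1] by simp
  ultimately show ?thesis by (rule has_integral_unique)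
qed

lemma phi_fn_strict_mono:
  assumes "0 \<le> x" "x < y" "y \<le> 1"
  shows "phi_fn s x < phi_fn s y"
proof (rule DERIV_pos_imp_increasing_open[OF assms(2)])
  fix u assume "x < u" "u < y"
  then show "\<exists>d. (phi_fn s has_real_derivative d) (at u) \<and> 0 < d"
    using assms has_field_derivative_phi_fn[OF s, of u] dphi_fn_pos[of u] by auto
next
  show "continuous_on {x..y} (phi_fn s)"
    using assms by (intro continuous_on_subset[OF continuous_on_phi_fn[OF s]]) auto
qed

lemma inj_on_phi_fn: "inj_on (phi_fn s) {0..1}"
proof (rule inj_onI)
  fix x y assume "x \<in> {0..1}" "y \<in> {0..1}" "phi_fn s x = phi_fn s y"
  then show "x = y"
    using phi_fn_strict_mono[of x y] phi_fn_strict_mono[of y x] by (cases x y rule: linorder_cases) auto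
qed

lemma phi_fn_image: "phi_fn s ` {0..1} = {0..pi / 2}"
proof -
  have "phi_fn s y \<in> {0..pi / 2}" if "y \<in> {0..1}" for y
    using that phi_fn_strict_mono[of 0 y] phi_fn_strict_mono[of y 1]
    by (cases "y = 0"; cases "y = 1") (auto simp: phi_fn_0 phi_fn_1)
  moreover have "\<exists>y\<in>{0..1}. phi_fn s y = x" if "x \<in> {0..pi / 2}" for x
    using IVT'[of "phi_fn s" 0 x 1] that continuous_on_phi_fn[OF s]
    by (auto simp: phi_fn_0 phi_fn_1)
  ultimately show ?thesis by (intro equalityI subsetI) (auto simp del: atLeastAtMost_iff)
qed

lemma y_fn_phi_fn: "0 \<le> y \<Longrightarrow> y \<le> 1 \<Longrightarrow> y_fn s (phi_fn s y) = y"
  unfolding y_fn_def by (rule the_inv_into_f_f[OF inj_on_phi_fn]) simp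

lemma phi_fn_y_fn: "0 \<le> x \<Longrightarrow> x \<le> pi / 2 \<Longrightarrow> phi_fn s (y_fn s x) = x"
  unfolding y_fn_def by (rule f_the_inv_into_f[OF inj_on_phi_fn]) (simp add: phi_fn_image)

lemma y_fn_mem: "0 \<le> x \<Longrightarrow> x \<le> pi / 2 \<Longrightarrow> y_fn s x \<in> {0..1}"
  unfolding y_fn_def by (rule the_inv_into_into[OF inj_on_phi_fn]) (simp_all add: phi_fn_image)

lemma y_fn_mem_open:
  assumes "0 < x" "x < pi / 2"
  shows "0 < y_fn s x" "y_fn s x < 1"
proof -
  have y: "0 \<le> y_fn s x" "y_fn s x \<le> 1" and x: "phi_fn s (y_fn s x) = x"
    using assms y_fn_mem[of x] phi_fn_y_fn[of x] by simp_all
  have "y_fn s x \<noteq> 0" "y_fn s x \<noteq> 1"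
    using x assms phi_fn_0 phi_fn_1 by auto
  with y show "0 < y_fn s x" "y_fn s x < 1" by simp_all
qed

lemma continuous_on_y_fn: "continuous_on {0..pi / 2} (y_fn s)"
  using continuous_on_inv[of "{0..1}" "phi_fn s" "y_fn s"] continuous_on_phi_fn[OF s] y_fn_phi_fn
  by (simp add: phi_fn_image)

lemma deriv_y_fn:
  assumes "0 < x" "x < pi / 2"
  shows "deriv (y_fn s) x = 1 / dphi_fn s (y_fn s x)"
proof -
  have y: "0 < y_fn s x" "y_fn s x < 1" using y_fn_mem_open[OF assms] .
  have "(y_fn s has_real_derivative inverse (dphi_fn s (y_fn s x))) (at x)"
  proof (rule DERIV_inverse_function)
    show "(phi_fn s has_real_derivative dphi_fn s (y_fn s x)) (at (y_fn s x))"
      by (rule has_field_derivative_phi_fn[OF s y])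
    show "dphi_fn s (y_fn s x) \<noteq> 0" using dphi_fn_pos[of "y_fn s x"] y by simp
    show "isCont (y_fn s) x"
      using continuous_on_y_fn assms
      by (intro continuous_on_interior[of "{0..pi / 2}"]) auto
    show "phi_fn s (y_fn s u) = u" if "0 < u" "u < pi / 2" for u
      using that by (intro phi_fn_y_fn) auto
  qed (use assms in auto)
  then show ?thesis by (simp add: DERIV_imp_deriv inverse_eq_divide)
qed

end

subsection \<open>The collision kernel in terms of the impact parameter\<close>

lemma sin_ge_linear:
  assumes "0 \<le> x" "x \<le> pi / 2"
  shows "2 * x / pi \<le> sin x"
proof -
  have "concave_on {0..pi} sin"
    by (rule f''_le0_imp_concave[where f' = cos and f'' = "\<lambda>x. - sin x"])
       (auto intro!: derivative_eq_intros sin_ge_zero)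
  then have "(1 - 2 * x / pi) * sin 0 + 2 * x / pi * sin (pi / 2)
      \<le> sin ((1 - 2 * x / pi) *\<^sub>R 0 + (2 * x / pi) *\<^sub>R (pi / 2))"
    using assms by (intro concave_onD) auto
  then show ?thesis by simp
qed

lemma cos_diff_le:
  fixes x y :: real
  assumes "x \<le> y"
  shows "cos x - cos y \<le> y - x"
proof (cases "x < y")
  case True
  have "\<exists>u>x. u < y \<and> cos y - cos x = (y - x) * (- sin u)"
    by (rule MVT2[OF True]) (auto intro!: derivative_eq_intros)
  then obtain u where "cos y - cos x = (y - x) * (- sin u)" by blast
  moreover have "(y - x) * sin u \<le> (y - x) * 1"
    using assms by (intro mult_left_mono) auto
  ultimately show ?thesis by simp
qed (use assms in simp)

lemma sin_diff_le:
  fixes x y :: real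
  assumes "x \<le> y"
  shows "sin y - sin x \<le> y - x"
  using cos_diff_le[of "x - pi / 2" "y - pi / 2"] cos_diff_le[of "pi / 2 - y" "pi / 2 - x"] assms
  by (simp add: cos_diff)

text \<open>Follows from \<open>s * ln (1 / s) \<le> 1 - s\<close>. The power arises because
  \<open>\<theta>\<close> is compared with \<open>e / sqrt s\<close> for small
  \<open>s\<close>.\<close>

lemma powr_minus_self_le_3:
  fixes s :: real
  assumes "0 < s" "s < 1"
  shows "s powr (- s) \<le> 3"
proof -
  have "ln (1 / s) \<le> 1 / s - 1" using assms by (intro ln_le_minus_one) simp
  then have "s * ln (1 / s) \<le> s * (1 / s - 1)" using assms by (intro mult_left_mono) auto
  also have "\<dots> \<le> 1" using assms by (simp add: algebra_simps)
  finally have "exp (s * ln (1 / s)) \<le> exp 1" by simp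
  also have "\<dots> \<le> 3" by (rule exp_le)
  finally show ?thesis using assms by (simp add: powr_def ln_div)
qed

text \<open>The usual two terms are combined so that the numerator differs from 1 by at most
  \<open>2 * s / (1 - y\<^sup>2)\<close>.\<close>

lemma beta_fn_has_derivative:
  assumes "0 \<le> y" "y < 1"
  shows "(beta_fn s has_real_derivative
    (1 + 2 * s * y\<^sup>2 / (1 - y\<^sup>2)) / (1 - y\<^sup>2) powr s) (at y)"
proof -
  define e where "e = 1 - y\<^sup>2"
  have e: "0 < e" using assms by (auto simp: abs_square_less_1 e_def)
  have "((\<lambda>y. (1 - y\<^sup>2) powr s) has_real_derivative s * e powr (s - 1) * (- (2 * y))) (at y)"
    using e unfolding e_def by (auto intro!: derivative_eq_intros)
  then have "((\<lambda>y. y / (1 - y\<^sup>2) powr s) has_real_derivative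
      (1 * e powr s - y * (s * e powr (s - 1) * (- (2 * y)))) / (e powr s * e powr s)) (at y)"
    using e unfolding e_def by (intro DERIV_divide DERIV_ident) auto
  also have "(1 * e powr s - y * (s * e powr (s - 1) * (- (2 * y)))) / (e powr s * e powr s)
      = (1 + 2 * s * y\<^sup>2 / e) / e powr s"
    using e by (simp add: powr_diff field_simps power2_eq_square)
  finally show ?thesis by (simp add: beta_fn_def[abs_def] e_def)
qed

context
  fixes s :: real
  assumes s: "0 < s" "s < 1"
begin

lemma phi_fn_mem_open:
  assumes "0 < y" "y < 1"
  shows "0 < phi_fn s y" "phi_fn s y < pi / 2"
  using phi_fn_strict_mono[OF s, of 0 y] phi_fn_strict_mono[OF s, of y 1] assms
  by (simp_all add: phi_fn_0[OF s] phi_fn_1[OF s])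

text \<open>Parametrising the angle by \<open>y\<close> removes the inverse function, and
  \<open>sin (pi - 2 * x) = 2 * (sin x * cos x)\<close>. The last factor is 1 when
  \<open>x = arcsin y\<close> and \<open>dphi_fn s y = 1 / sqrt e\<close>.\<close>

lemma b_formula_phi_fn:
  assumes "0 < y" "y < 1"
  defines "e \<equiv> 1 - y\<^sup>2" and "x \<equiv> phi_fn s y"
  shows "b_formula s (pi - 2 * x) = 2 powr (4 * s) / 4 * e powr (- 2 * s) *
    (1 + 2 * s * y\<^sup>2 / e) * (y / (sin x * cos x * dphi_fn s y))"
proof -
  have x: "0 < x" "x < pi / 2" using phi_fn_mem_open[OF assms(1,2)] by (simp_all add: x_def)
  have e: "0 < e" using assms by (auto simp: abs_square_less_1 e_def)
  have y: "y_fn s x = y" using y_fn_phi_fn[OF s, of y] assms by (simp add: x_def)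
  have "deriv (beta_fn s) y = (1 + 2 * s * y\<^sup>2 / e) / e powr s"
    unfolding e_def using assms by (intro DERIV_imp_deriv beta_fn_has_derivative) auto
  moreover have "deriv (y_fn s) x = 1 / dphi_fn s y"
    using deriv_y_fn[OF s x] y by simp
  moreover have "sin (pi - 2 * x) = 2 * (sin x * cos x)"
    by (simp add: sin_double)
  moreover have "e powr (- 2 * s) = 1 / (e powr s * e powr s)"
    by (simp add: powr_minus inverse_eq_divide flip: powr_add)
  ultimately show ?thesis
    unfolding b_formula_def Let_def by (simp add: y beta_fn_def e_def[symmetric] mult_ac)
qed

text \<open>All but the third bound transfer
  \<open>arcsin y \<le> x \<le> arcsin y + 2 * s * y / sqrt e\<close> to sine and cosine, by
  monotonicity or by the Lipschitz constant 1. The third is the chord below the sine, taken at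
  \<open>pi / 2 - x\<close>.\<close>

lemma sin_cos_phi_fn_bounds:
  assumes "0 < y" "y < 1"
  defines "e \<equiv> 1 - y\<^sup>2" and "x \<equiv> phi_fn s y"
  shows "y \<le> sin x" "cos x \<le> sqrt e" "1 - 2 * x / pi \<le> cos x"
    "sin x \<le> y * (1 + 2 * (s / e))" "sqrt e * (1 - 2 * (s / e)) \<le> cos x"
proof -
  have x: "0 < x" "x < pi / 2" using phi_fn_mem_open[OF assms(1,2)] by (simp_all add: x_def)
  have e: "0 < e" "e \<le> 1" using assms by (auto simp: abs_square_less_1 e_def)
  have ax: "arcsin y \<le> x" using phi_fn_ge_arcsin[OF s, of y] assms by (simp add: x_def)
  have xa: "x \<le> arcsin y + 2 * s * y / sqrt e"
    using phi_fn_le_arcsin[OF s, of y] assms by (simp add: x_def e_def)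
  have a: "0 \<le> arcsin y" using arcsin_le_arcsin[of 0 y] assms by simp
  have sa: "sin (arcsin y) = y" using assms by simp
  have ca: "cos (arcsin y) = sqrt e" using assms by (simp add: cos_arcsin e_def)
  have "sin (arcsin y) \<le> sin x" using x a ax by (intro sin_monotone_2pi_le) auto
  then show "y \<le> sin x" using sa by simp
  have "cos x \<le> cos (arcsin y)" using x a ax by (intro cos_monotone_0_pi_le) auto
  then show "cos x \<le> sqrt e" using ca by simp
  have "2 * (pi / 2 - x) / pi \<le> sin (pi / 2 - x)" using x by (intro sin_ge_linear) auto
  then show "1 - 2 * x / pi \<le> cos x" by (simp add: cos_sin_eq diff_divide_distrib)
  \<comment> \<open>Since \<open>e \<le> 1\<close>, the denominator \<open>sqrt e\<close> may be
    replaced by \<open>e\<close>, so that the error is expressed by \<open>s / e\<close>.\<close>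
  have se: "e \<le> sqrt e" using e by (intro real_le_rsqrt) (simp add: power2_eq_square mult_left_le)
  have "sin x \<le> y + 2 * s * y / sqrt e" using sin_diff_le[OF ax] xa sa by simp
  also have "2 * s * y / sqrt e \<le> 2 * s * y / e"
    using se e s assms by (intro divide_left_mono) auto
  finally show "sin x \<le> y * (1 + 2 * (s / e))" by (simp add: algebra_simps)
  have "2 * s * y / sqrt e \<le> 2 * s * 1 / sqrt e"
    using e s assms by (intro divide_right_mono mult_left_mono) auto
  also have "\<dots> = sqrt e * (2 * (s / e))"
    using e by (simp add: field_simps)
  finally show "sqrt e * (1 - 2 * (s / e)) \<le> cos x"
    using cos_diff_le[OF ax] xa ca by (simp add: algebra_simps)
qed

text \<open>The angle is \<open>2 * (phi_fn s 1 - phi_fn s y)\<close>, so the mean value theorem on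
  \<open>{y..1}\<close> and \<open>1 - y \<le> 1 - y\<^sup>2\<close> suffice.\<close>

lemma angle_le_of_dphi_fn_le:
  assumes "0 < y" "y < 1" and M: "\<And>u. 0 \<le> u \<Longrightarrow> u < 1 \<Longrightarrow> dphi_fn s u \<le> M"
  shows "pi - 2 * phi_fn s y \<le> 2 * (1 - y\<^sup>2) * M"
proof -
  have "\<exists>d u. y < u \<and> u < 1 \<and> (phi_fn s has_real_derivative d) (at u) \<and>
      phi_fn s 1 - phi_fn s y = (1 - y) * d"
    using assms
    by (intro MVT continuous_on_subset[OF continuous_on_phi_fn[OF s]])
       (auto simp: real_differentiable_def intro!: has_field_derivative_phi_fn[OF s] exI)
  then obtain d u where u: "y < u" "u < 1" "(phi_fn s has_real_derivative d) (at u)"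
    "phi_fn s 1 - phi_fn s y = (1 - y) * d" by blast
  have "d = dphi_fn s u"
    using DERIV_unique[OF u(3)] has_field_derivative_phi_fn[OF s, of u] u assms by simp
  then have "0 \<le> d" "d \<le> M" using M[of u] dphi_fn_pos[OF s, of u] u assms by auto
  moreover have "1 - y \<le> 1 - y\<^sup>2" using assms by (simp add: power2_eq_square mult_left_le)
  ultimately have "(1 - y) * d \<le> (1 - y\<^sup>2) * M" using assms by (intro mult_mono) auto
  then show ?thesis using u(4) phi_fn_1[OF s] by linarith
qed

end

subsection \<open>Bounds for the collision kernel\<close>

lemma perturbation_upper_le:
  fixes r :: real
  assumes "0 \<le> r" "r \<le> 1 / 4"
  shows "exp (4 * r) * (1 + 2 * r) / (1 - 2 * r)\<^sup>2 \<le> 1 + 72 * r"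
proof -
  have rr: "r * r \<le> r / 4" "0 \<le> r * r" using assms mult_left_mono[of r "1/4" r] by auto
  have "exp (4 * r) \<le> 1 + 4 * r + (4 * r)\<^sup>2" using assms by (intro exp_bound) auto
  also have "\<dots> \<le> 1 + 8 * r" using rr by (simp add: power2_eq_square)
  finally have "exp (4 * r) * (1 + 2 * r) \<le> (1 + 8 * r) * (1 + 2 * r)"
    using assms by (intro mult_right_mono) auto
  also have "\<dots> \<le> 1 + 14 * r" using rr by (simp add: algebra_simps)
  \<comment> \<open>The constant satisfies \<open>72 / 4 - 4 = 14\<close>: the square is at least
    \<open>1 / 4\<close> in the linear term and at least \<open>1 - 4 * r\<close> in the constant
    term.\<close>
  also have "\<dots> \<le> (1 + 72 * r) * (1 - 2 * r)\<^sup>2"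
  proof -
    have "(1 / 2)\<^sup>2 \<le> (1 - 2 * r)\<^sup>2" using assms by (intro power_mono) auto
    then have "72 * r * (1 / 4) \<le> 72 * r * (1 - 2 * r)\<^sup>2"
      using assms by (intro mult_left_mono) (auto simp: power2_eq_square)
    moreover have "1 - 4 * r \<le> (1 - 2 * r)\<^sup>2" using rr by (simp add: power2_eq_square algebra_simps)
    ultimately show ?thesis by (simp add: algebra_simps)
  qed
  finally show ?thesis using assms by (simp add: divide_le_eq)
qed

lemma perturbation_lower_ge:
  fixes r :: real
  assumes "0 \<le> r"
  shows "1 - 4 * r \<le> 1 / (1 + 2 * r)\<^sup>2"
proof -
  have "(1 - 4 * r) * (1 + 2 * r)\<^sup>2 = 1 - 12 * (r * r) - 16 * (r * r * r)"
    by (simp add: power2_eq_square algebra_simps)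
  also have "\<dots> \<le> 1"
  proof -
    have "0 \<le> r * r" "0 \<le> r * r * r" using assms by auto
    then show ?thesis by linarith
  qed
  finally show ?thesis using assms by (simp add: le_divide_eq)
qed

context
  fixes s :: real
  assumes s: "0 < s" "s < 1"
begin

text \<open>Four times the kernel is written as \<open>P * Q / (S * c * d)\<close>, where every
  factor is 1 up to order \<open>r = s / e\<close>; the constant 18 is
  \<open>72 / 4\<close>.\<close>

lemma b_formula_near_quarter:
  assumes "0 < y" "y < 1"
  defines "e \<equiv> 1 - y\<^sup>2"
  assumes big: "4 * s < e"
  shows "\<bar>b_formula s (pi - 2 * phi_fn s y) - 1 / 4\<bar> \<le> 18 * (s / e)"
proof -
  define x where "x = phi_fn s y"
  define D where "D = dphi_fn s y"
  define r where "r = s / e"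
  have e: "0 < e" "e \<le> 1" using assms by (auto simp: abs_square_less_1 e_def)
  have r: "0 < r" "r < 1 / 4" using s e big by (auto simp: r_def field_simps)
  have sr: "s \<le> r" using s e by (simp add: r_def field_simps)
  have D: "0 < D" unfolding D_def using dphi_fn_pos[OF s, of y] assms by simp
  have x: "0 < x" "x < pi / 2" using phi_fn_mem_open[OF s assms(1,2)] by (simp_all add: x_def)
  \<comment> \<open>\<open>S\<close>, \<open>c\<close> and \<open>d\<close> are quotients by the
    values for \<open>w = 0\<close>.\<close>
  define S where "S = sin x / y"
  define c where "c = cos x / sqrt e"
  define d where "d = sqrt e * D"
  have S: "1 \<le> S" "S \<le> 1 + 2 * r"
    using sin_cos_phi_fn_bounds(1,4)[OF s assms(1,2)] assms(1)
    by (simp_all add: S_def x_def e_def r_def field_simps)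
  have c: "1 - 2 * r \<le> c" "c \<le> 1"
    using sin_cos_phi_fn_bounds(2,5)[OF s assms(1,2)] e
    by (simp_all add: c_def x_def r_def le_divide_eq divide_le_eq mult.commute flip: e_def)
  have d: "1 - 2 * r \<le> d" "d \<le> 1 + 2 * r"
  proof -
    have "sqrt e * D \<le> sqrt e * (1 / sqrt e + 2 * s / (e * sqrt e))"
      using dphi_fn_near_inverse_sqrt(1)[OF s, of y] assms e
      by (intro mult_left_mono) (auto simp: D_def)
    also have "\<dots> = 1 + 2 * r" using e by (simp add: r_def field_simps)
    finally show "d \<le> 1 + 2 * r" by (simp add: d_def)
    have "1 - 2 * r = sqrt e * (1 / sqrt e - 2 * s / (e * sqrt e))"
      using e by (simp add: r_def field_simps)
    also have "\<dots> \<le> sqrt e * D"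
      using dphi_fn_near_inverse_sqrt(2)[OF s, of y] assms e
      by (intro mult_left_mono) (auto simp: D_def)
    finally show "1 - 2 * r \<le> d" by (simp add: d_def)
  qed
  define P where "P = 2 powr (4 * s) * e powr (- 2 * s)"
  define Q where "Q = 1 + 2 * s * y\<^sup>2 / e"
  have P: "1 \<le> P" "P \<le> exp (4 * r)"
  proof -
    have "1 * 1 \<le> 2 powr (4 * s) * e powr (- 2 * s)"
      using s e powr_mono2'[of "- 2 * s" e 1] by (intro mult_mono) (auto simp: ge_one_powr_ge_zero)
    then show "1 \<le> P" by (simp add: P_def)
    \<comment> \<open>The logarithm of \<open>P\<close> is \<open>s * (4 * ln 2 - 2 * ln e)\<close>;
      together with \<open>s \<le> r\<close> it is at most \<open>4 * r\<close>.\<close>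
    have "ln (1 / e) \<le> 1 / e - 1" using e by (intro ln_le_minus_one) simp
    then have "- ln e \<le> 1 / e - 1" using e by (simp add: ln_div)
    moreover have "ln 2 \<le> (1::real)" using ln_le_minus_one[of 2] by simp
    ultimately have "4 * ln 2 - 2 * ln e \<le> 2 + 2 * (1 / e)" by linarith
    then have "s * (4 * ln 2 - 2 * ln e) \<le> s * (2 + 2 * (1 / e))"
      using s by (intro mult_left_mono) auto
    also have "\<dots> = 2 * s + 2 * r" by (simp add: r_def algebra_simps)
    also have "\<dots> \<le> 4 * r" using sr by simp
    finally have "exp (s * (4 * ln 2 - 2 * ln e)) \<le> exp (4 * r)" by simp
    moreover have "exp (s * (4 * ln 2 - 2 * ln e)) = P"
      using e by (simp add: P_def powr_def algebra_simps flip: exp_add)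
    ultimately show "P \<le> exp (4 * r)" by simp
  qed
  have Q: "1 \<le> Q" "Q \<le> 1 + 2 * r"
  proof -
    show "1 \<le> Q" using s e by (simp add: Q_def)
    have "s * y\<^sup>2 / e \<le> s * 1 / e"
      using s e assms by (intro divide_right_mono mult_left_mono) (auto simp: power_le_one)
    then show "Q \<le> 1 + 2 * r" by (simp add: Q_def r_def)
  qed
  have "y / (sin x * cos x * D) = 1 / (S * c * d)"
    using e assms(1) by (simp add: S_def c_def d_def field_simps)
  then have b: "4 * b_formula s (pi - 2 * x) = P * Q / (S * c * d)"
    using b_formula_phi_fn[OF s assms(1,2)] by (simp add: P_def Q_def x_def D_def e_def)
  have "P * Q / (S * c * d) \<le> exp (4 * r) * (1 + 2 * r) / (1 * (1 - 2 * r) * (1 - 2 * r))"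
    using P Q S c d r by (intro frac_le mult_mono) auto
  also have "\<dots> \<le> 1 + 72 * r"
    using perturbation_upper_le[of r] r by (simp add: power2_eq_square)
  finally have up: "P * Q / (S * c * d) \<le> 1 + 72 * r" .
  have "1 - 4 * r \<le> 1 * 1 / ((1 + 2 * r) * 1 * (1 + 2 * r))"
    using perturbation_lower_ge[of r] r by (simp add: power2_eq_square)
  also have "\<dots> \<le> P * Q / (S * c * d)"
    using P Q S c d r by (intro frac_le mult_mono) auto
  finally show ?thesis using up b r unfolding r_def[symmetric] x_def[symmetric] by linarith
qed

text \<open>\<open>y \<le> sin x\<close> and \<open>\<theta> / pi \<le> cos x\<close> bound the last
  factor in every regime. The derivative \<open>dphi_fn s y\<close> is kept, because its lower bound
  depends on the regime.\<close>

lemma b_formula_bounds: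
  assumes "0 < y" "y < 1"
  defines "e \<equiv> 1 - y\<^sup>2" and "\<theta> \<equiv> pi - 2 * phi_fn s y"
  shows "0 \<le> b_formula s \<theta>"
    "b_formula s \<theta> \<le> 2 powr (4 * s) / 4 * e powr (- 2 * s) * (1 + 2 * s / e) * (pi / \<theta> / dphi_fn s y)"
proof -
  define x where "x = phi_fn s y"
  define D where "D = dphi_fn s y"
  have e: "0 < e" "e \<le> 1" using assms by (auto simp: abs_square_less_1 e_def)
  have D: "0 < D" unfolding D_def using dphi_fn_pos[OF s, of y] assms by simp
  have x: "0 < x" "x < pi / 2" using phi_fn_mem_open[OF s assms(1,2)] by (simp_all add: x_def)
  have t: "0 < \<theta>" using x by (simp add: \<theta>_def x_def)
  have c: "\<theta> / pi \<le> cos x"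
    using sin_cos_phi_fn_bounds(3)[OF s assms(1,2)] by (simp add: \<theta>_def x_def diff_divide_distrib)
  have sn: "y \<le> sin x" using sin_cos_phi_fn_bounds(1)[OF s assms(1,2)] by (simp add: x_def)
  have b: "b_formula s \<theta> = 2 powr (4 * s) / 4 * e powr (- 2 * s) *
      (1 + 2 * s * y\<^sup>2 / e) * (y / (sin x * cos x * D))"
    using b_formula_phi_fn[OF s assms(1,2)] by (simp add: e_def x_def \<theta>_def D_def)
  have c0: "0 < cos x" using x by (simp add: cos_gt_zero)
  then show "0 \<le> b_formula s \<theta>"
    unfolding b using s e D assms(1) sn by simp
  have "y / (sin x * cos x * D) \<le> y / (y * (\<theta> / pi) * D)"
    using sn c D t assms(1) c0 by (intro divide_left_mono mult_right_mono mult_mono mult_pos_pos) auto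
  also have "\<dots> = pi / \<theta> / D" using assms(1) by simp
  finally have q: "y / (sin x * cos x * D) \<le> pi / \<theta> / D" .
  have "s * y\<^sup>2 / e \<le> s * 1 / e"
    using s e assms by (intro divide_right_mono mult_left_mono) (auto simp: power_le_one)
  then have "1 + 2 * s * y\<^sup>2 / e \<le> 1 + 2 * s / e" by simp
  then show "b_formula s \<theta> \<le> 2 powr (4 * s) / 4 * e powr (- 2 * s) * (1 + 2 * s / e) * (pi / \<theta> / dphi_fn s y)"
    unfolding b D_def[symmetric] using q s e D sn c0 assms(1)
    by (intro mult_mono mult_left_mono) auto
qed

text \<open>\<open>\<theta> < 4\<close> and \<open>2 * s < 2\<close> give
  \<open>\<theta> powr (2 * s) \<le> 16\<close>.\<close>

lemma angle_powr_ge: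
  assumes "0 < \<theta>" "\<theta> \<le> pi"
  shows "1 / 16 \<le> \<theta> powr (- 2 * s)"
proof -
  have "\<theta> powr (2 * s) \<le> 4 powr (2 * s)"
    using assms s pi_less_4 by (intro powr_mono2) auto
  also have "\<dots> \<le> 4 powr 2" using s by (intro powr_mono) auto
  finally have "\<theta> powr (2 * s) \<le> 16" by simp
  then have "1 / 16 \<le> 1 / \<theta> powr (2 * s)" using assms by (intro divide_left_mono) auto
  then show ?thesis by (simp add: powr_minus_divide)
qed

text \<open>\<open>e \<ge> \<theta> * s / 4\<close> turns negative powers of \<open>e\<close> into
  those of \<open>\<theta>\<close>, and \<open>dphi_fn\<close> is bounded below by a constant. The
  constant 25000 leaves room for the factor \<open>s \<ge> 1 / 2\<close> of the final bound.\<close>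

lemma b_formula_bound_large_s:
  assumes "0 < y" "y < 1" "1 / 2 \<le> s"
  defines "\<theta> \<equiv> pi - 2 * phi_fn s y"
  shows "b_formula s \<theta> \<le> 25000 * (\<theta> powr (- 2 * s) / \<theta>\<^sup>2)"
proof -
  define e where "e = 1 - y\<^sup>2"
  define D where "D = dphi_fn s y"
  define T where "T = \<theta> powr (- 2 * s)"
  have e: "0 < e" "e \<le> 1" using assms by (auto simp: abs_square_less_1 e_def)
  have t: "0 < \<theta>" using phi_fn_mem_open[OF s assms(1,2)] by (simp add: \<theta>_def)
  have "\<theta> \<le> 2 * e * (2 / s)"
    unfolding \<theta>_def e_def using assms dphi_fn_le_inverse[OF s]
    by (intro angle_le_of_dphi_fn_le[OF s]) auto
  then have te: "\<theta> * s / 4 \<le> e" using s by (simp add: field_simps)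
  have D: "1 / sqrt 2 \<le> D" unfolding D_def using assms by (intro dphi_fn_ge_half[OF s]) auto
  have D0: "0 < D" using D by (rule less_le_trans[rotated]) simp
  have "1 / D \<le> sqrt 2" using D D0 by (simp add: field_simps)
  also have "sqrt 2 \<le> 3 / 2" by (rule real_le_lsqrt) (auto simp: power2_eq_square)
  finally have D1: "1 / D \<le> 3 / 2" .
  have ps: "(4 / s) powr (2 * s) \<le> 64"
  proof -
    have "(4 / s) powr (2 * s) \<le> (4 / s) powr 2" using s by (intro powr_mono) (auto simp: field_simps)
    also have "\<dots> \<le> 8 powr 2" using s assms by (intro powr_mono2) (auto simp: field_simps)
    finally show ?thesis by simp
  qed
  have "e powr (- 2 * s) \<le> (\<theta> * (s / 4)) powr (- 2 * s)"
    using te t s by (intro powr_mono2') auto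
  also have "\<dots> = T * (s / 4) powr (- 2 * s)" using t s by (subst powr_mult) (auto simp: T_def)
  also have "(s / 4) powr (- 2 * s) = (4 / s) powr (2 * s)"
    using s by (simp add: powr_minus powr_divide)
  also have "T * (4 / s) powr (2 * s) \<le> T * 64" using ps by (intro mult_left_mono) (auto simp: T_def)
  finally have eT: "e powr (- 2 * s) \<le> T * 64" .
  have "1 + 2 * s / e \<le> (1 + 2 * s) / e" using e by (simp add: field_simps)
  also have "\<dots> \<le> (1 + 2 * s) / (\<theta> * s / 4)" using te t s e by (intro divide_left_mono) auto
  also have "\<dots> = (4 / s + 8) / \<theta>" using s t by (simp add: field_simps)
  also have "\<dots> \<le> 16 / \<theta>" using s t assms by (intro divide_right_mono) (auto simp: field_simps)
  finally have fe: "1 + 2 * s / e \<le> 16 / \<theta>" .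
  have "pi / \<theta> / D = pi / \<theta> * (1 / D)" by simp
  also have "\<dots> \<le> 16 / 5 / \<theta> * (3 / 2)"
    using D1 D0 t pi_approx by (intro mult_mono divide_right_mono) auto
  finally have fD: "pi / \<theta> / D \<le> 24 / 5 / \<theta>" by simp
  have "2 powr (4 * s) \<le> 2 powr 4" using s by (intro powr_mono) auto
  then have f2: "2 powr (4 * s) \<le> 16" by simp
  have "b_formula s \<theta> \<le> 2 powr (4 * s) / 4 * e powr (- 2 * s) * (1 + 2 * s / e) * (pi / \<theta> / D)"
    using b_formula_bounds(2)[OF assms(1,2)] by (simp add: \<theta>_def e_def D_def)
  \<comment> \<open>The constant is \<open>4 * 64 * 16 * 24 / 5\<close>.\<close>
  also have "\<dots> \<le> 16 / 4 * (T * 64) * (16 / \<theta>) * (24 / 5 / \<theta>)"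
    using f2 eT fe fD e s D0 t by (intro mult_mono) (auto simp: T_def)
  also have "\<dots> = 98304 / 5 * (T / \<theta>\<^sup>2)" by (simp add: power2_eq_square)
  also have "\<dots> \<le> 25000 * (T / \<theta>\<^sup>2)" by (intro mult_right_mono) (auto simp: T_def)
  finally show ?thesis by (simp add: T_def)
qed

text \<open>The arctangent quotient \<open>A\<close> bounds \<open>dphi_fn\<close> on both sides, so
  it cancels in \<open>\<theta> \<le> 60 * e * D\<close>. The \<open>e\<close> in
  \<open>1 / D \<le> 60 * e / \<theta>\<close> then cancels against
  \<open>1 + 2 * s / e \<le> 6 * s / e\<close>, which leaves the required factor
  \<open>s\<close>.\<close>

lemma b_formula_bound_small_s:
  assumes "0 < y" "y < 1" "s \<le> 1 / 2" "1 - y\<^sup>2 \<le> 4 * s"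
  defines "\<theta> \<equiv> pi - 2 * phi_fn s y"
  shows "b_formula s \<theta> \<le> 50000 * s * (\<theta> powr (- 2 * s) / \<theta>\<^sup>2)"
proof -
  define e where "e = 1 - y\<^sup>2"
  define D where "D = dphi_fn s y"
  define T where "T = \<theta> powr (- 2 * s)"
  define A where "A = arctan (1 / sqrt s) / sqrt s"
  have e: "0 < e" "e \<le> 1" "e \<le> 4 * s" using assms by (auto simp: abs_square_less_1 e_def)
  have t: "0 < \<theta>" using phi_fn_mem_open[OF s assms(1,2)] by (simp add: \<theta>_def)
  have A: "0 < A" "A \<le> pi / 2 / sqrt s"
  proof -
    show "0 < A" using s by (simp add: A_def)
    show "A \<le> pi / 2 / sqrt s"
      unfolding A_def using s arctan_ubound[of "1 / sqrt s"] by (intro divide_right_mono less_imp_le) auto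
  qed
  have te: "\<theta> \<le> 2 * e * (4 * A)"
    unfolding \<theta>_def e_def A_def using assms dphi_fn_le_arctan[OF s]
    by (intro angle_le_of_dphi_fn_le[OF s]) auto
  have D0: "0 < D" unfolding D_def using dphi_fn_pos[OF s, of y] assms by simp
  define C where "C = 2 + e / s"
  have C: "0 < C" "C \<le> 6" using e s by (auto simp: C_def field_simps add_pos_pos)
  \<comment> \<open>\<open>C \<le> 6\<close> makes \<open>C * sqrt C\<close> at most 15.\<close>
  have "sqrt 6 \<le> 5 / 2" by (rule real_le_lsqrt) (auto simp: power2_eq_square)
  moreover have "sqrt C \<le> sqrt 6" using C by simp
  ultimately have "sqrt C \<le> 5 / 2" by linarith
  then have "C * sqrt C \<le> 6 * (5 / 2)" using C by (intro mult_mono) auto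
  then have "2 * A / 15 \<le> 2 * A / (C * sqrt C)" using A C by (intro divide_left_mono) auto
  also have "\<dots> \<le> D"
    using dphi_fn_ge_arctan[OF s, of y] assms by (simp add: A_def D_def C_def e_def)
  finally have DA: "2 * A / 15 \<le> D" .
  have "\<theta> \<le> e * (60 * (2 * A / 15))" using te by simp
  also have "\<dots> \<le> e * (60 * D)" using DA e by (intro mult_left_mono) auto
  finally have "1 / D \<le> 60 * e / \<theta>" using D0 t by (simp add: field_simps)
  then have "pi / \<theta> * (1 / D) \<le> 63 / 20 / \<theta> * (60 * e / \<theta>)"
    using t D0 pi_approx by (intro mult_mono divide_right_mono) auto
  then have fD: "pi / \<theta> / D \<le> 189 * e / \<theta>\<^sup>2" by (simp add: power2_eq_square)
  \<comment> \<open>For the power of \<open>e\<close> the size of \<open>A\<close> matters: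
    \<open>A \<le> pi / 2 / sqrt s\<close> bounds \<open>e\<close> below by a multiple of
    \<open>\<theta> * sqrt s\<close>.\<close>
  have "pi / 2 / sqrt s \<le> 63 / 40 / sqrt s"
    using s pi_approx by (intro divide_right_mono) auto
  then have "2 * e * (4 * A) \<le> 2 * e * (4 * (63 / 40 / sqrt s))"
    using A e by (intro mult_left_mono) auto
  also have "\<dots> = e * (63 / 5 / sqrt s)" by simp
  finally have "\<theta> \<le> e * (63 / 5 / sqrt s)" using te by simp
  then have te2: "\<theta> * (sqrt s * (5 / 63)) \<le> e" using s by (simp add: field_simps)
  have "e powr (- 2 * s) \<le> (\<theta> * (sqrt s * (5 / 63))) powr (- 2 * s)"
    using te2 t s by (intro powr_mono2') auto
  also have "\<dots> = T * (sqrt s powr (- 2 * s) * (5 / 63) powr (- 2 * s))"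
    unfolding T_def by (simp only: powr_mult)
  also have "sqrt s powr (- 2 * s) = s powr (- s)"
    using s by (simp add: powr_half_sqrt[symmetric] powr_powr)
  also have "T * (s powr (- s) * (5 / 63) powr (- 2 * s)) \<le> T * (3 * (63 / 5))"
  proof (intro mult_left_mono mult_mono)
    show "s powr (- s) \<le> 3" by (rule powr_minus_self_le_3[OF s])
    have "(5 / 63) powr (- 2 * s) = (63 / 5) powr (2 * s)"
      by (simp add: powr_minus powr_divide)
    also have "\<dots> \<le> (63 / 5) powr 1" using assms by (intro powr_mono) auto
    finally show "(5 / 63) powr (- 2 * s) \<le> 63 / 5" by simp
  qed (auto simp: T_def)
  finally have eT: "e powr (- 2 * s) \<le> T * (189 / 5)" by simp
  have fe: "1 + 2 * s / e \<le> 6 * s / e" using e s by (simp add: field_simps)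
  have "2 powr (4 * s) \<le> 2 powr 2" using assms by (intro powr_mono) auto
  then have f2: "2 powr (4 * s) \<le> 4" by simp
  have "b_formula s \<theta> \<le> 2 powr (4 * s) / 4 * e powr (- 2 * s) * (1 + 2 * s / e) * (pi / \<theta> / D)"
    using b_formula_bounds(2)[OF assms(1,2)] by (simp add: \<theta>_def e_def D_def)
  also have "\<dots> \<le> 4 / 4 * (T * (189 / 5)) * (6 * s / e) * (189 * e / \<theta>\<^sup>2)"
    using f2 eT fe fD e s D0 t by (intro mult_mono) (auto simp: T_def)
  also have "\<dots> = 214326 / 5 * (s * (T / \<theta>\<^sup>2))" using e by simp
  also have "\<dots> \<le> 50000 * (s * (T / \<theta>\<^sup>2))" using s by (intro mult_right_mono) (auto simp: T_def)
  finally show ?thesis by (simp add: T_def)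
qed

lemma b_formula_bound:
  assumes "0 < \<theta>" "\<theta> < pi"
  shows "\<bar>b_formula s \<theta> - 1 / 4\<bar> \<le> 50000 * s * \<theta> powr (- 2 - 2 * s)"
proof -
  define y where "y = y_fn s ((pi - \<theta>) / 2)"
  have y: "0 < y" "y < 1"
    unfolding y_def using assms by (intro y_fn_mem_open[OF s]; simp)+
  have \<theta>: "\<theta> = pi - 2 * phi_fn s y"
    using phi_fn_y_fn[OF s, of "(pi - \<theta>) / 2"] assms by (simp add: y_def)
  define e where "e = 1 - y\<^sup>2"
  have e: "0 < e" "e \<le> 1" using y by (auto simp: abs_square_less_1 e_def)
  define T where "T = \<theta> powr (- 2 * s)"
  have T: "1 / 16 \<le> T" unfolding T_def using assms by (intro angle_powr_ge) auto
  \<comment> \<open>The upper and the lower bound for \<open>cos x\<close> are combined;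
    \<open>\<theta>\<^sup>2 \<le> 16 * e\<close> follows for every \<open>s\<close>.\<close>
  have "\<theta> / pi \<le> sqrt e"
    using sin_cos_phi_fn_bounds(2,3)[OF s y] by (simp add: \<theta> e_def diff_divide_distrib)
  then have "\<theta> \<le> pi * sqrt e" by (simp add: field_simps)
  then have "\<theta>\<^sup>2 \<le> (pi * sqrt e)\<^sup>2" using assms by (intro power_mono) auto
  also have "\<dots> = pi\<^sup>2 * e" using e by (simp add: power_mult_distrib)
  also have "\<dots> \<le> 16 * e"
    using power_mono[of pi 4 2] pi_less_4 e by (intro mult_right_mono) auto
  finally have te: "\<theta>\<^sup>2 \<le> 16 * e" .
  have T0: "0 < T / \<theta>\<^sup>2" using T assms by simp
  \<comment> \<open>This is \<open>1 / e \<le> 256 * (T / \<theta>\<^sup>2)\<close>, which turns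
    \<open>s / e\<close> into the right-hand side.\<close>
  have Te: "1 / 256 \<le> T / \<theta>\<^sup>2 * e"
  proof -
    have "\<theta>\<^sup>2 * (1 / 16) \<le> 16 * e * T" using te T e by (intro mult_mono) auto
    then show ?thesis using assms by (simp add: field_simps)
  qed
  have *: "\<theta> powr (- 2 - 2 * s) = T / \<theta>\<^sup>2"
    using assms by (simp add: powr_diff T_def powr_minus divide_inverse mult.commute)
  have b0: "0 \<le> b_formula s \<theta>" using b_formula_bounds(1)[OF y] by (simp add: \<theta>)
  \<comment> \<open>If \<open>e \<le> 4 * s\<close>, then \<open>Te\<close> puts
    \<open>1 / 4\<close> itself below the bound, and two numbers between 0 and \<open>M\<close>
    differ by at most \<open>M\<close>.\<close>
  have small: "\<bar>b_formula s \<theta> - 1 / 4\<bar> \<le> 50000 * s * (T / \<theta>\<^sup>2)"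
    if "e \<le> 4 * s" "b_formula s \<theta> \<le> 50000 * s * (T / \<theta>\<^sup>2)"
  proof -
    have "T / \<theta>\<^sup>2 * e \<le> T / \<theta>\<^sup>2 * (4 * s)" using that T0 by (intro mult_left_mono) auto
    with Te have "1 / 4 \<le> 50000 * (T / \<theta>\<^sup>2 * s)" by linarith
    then have "1 / 4 \<le> 50000 * s * (T / \<theta>\<^sup>2)" by (simp add: mult_ac)
    then show ?thesis using that b0 by linarith
  qed
  consider "1 / 2 \<le> s" | "s < 1 / 2" "e \<le> 4 * s" | "4 * s < e" by linarith
  then have "\<bar>b_formula s \<theta> - 1 / 4\<bar> \<le> 50000 * s * (T / \<theta>\<^sup>2)"
  proof cases
    case 1
    have "b_formula s \<theta> \<le> 25000 * (T / \<theta>\<^sup>2)"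
      using b_formula_bound_large_s[OF y 1] by (simp add: \<theta> T_def)
    also have "\<dots> \<le> 50000 * s * (T / \<theta>\<^sup>2)" using 1 T0 by (intro mult_right_mono) auto
    \<comment> \<open>For \<open>s \<ge> 1 / 2\<close> the condition \<open>e \<le> 4 * s\<close>
      follows from \<open>e \<le> 1\<close>.\<close>
    finally show ?thesis using 1 e by (intro small) auto
  next
    case 2
    then show ?thesis
      using b_formula_bound_small_s[OF y] by (intro small) (auto simp: \<theta> T_def e_def)
  next
    case 3
    have "\<bar>b_formula s \<theta> - 1 / 4\<bar> \<le> 18 * (s / e)"
      using b_formula_near_quarter[OF y] 3 by (simp add: \<theta> e_def)
    also have "s / e \<le> 256 * s * (T / \<theta>\<^sup>2)"
      using mult_left_mono[OF Te, of "256 * s / e"] s e by (simp add: mult_ac)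
    also have "18 * (256 * s * (T / \<theta>\<^sup>2)) \<le> 50000 * s * (T / \<theta>\<^sup>2)"
    proof -
      have "18 * (256 * s * u) \<le> 50000 * s * u" if "0 < u" for u
        using mult_pos_pos[OF s(1) that] by linarith
      then show ?thesis using T0 .
    qed
    finally show ?thesis by simp
  qed
  then show ?thesis by (simp add: *)
qed

section \<open>The limit at \<open>\<theta> = pi\<close>\<close>

lemma mean_inverse_sqrt_g_fn_0_pos: "0 < integral {0<..<1} (\<lambda>z. 1 / sqrt (g_fn s 0 z))"
proof -
  have "(\<lambda>z. 1 / sqrt (g_fn s 0 z)) integrable_on {0<..<1}"
    using inverse_sqrt_g_fn_le[OF s, of 0] g_fn_pos[OF s, of 0, THEN less_imp_le]
    by (intro integrable_on_inverse_sqrt_bound[where C = 1]) auto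
  then have I: "((\<lambda>z. 1 / sqrt (g_fn s 0 z)) has_integral integral {0<..<1} (\<lambda>z. 1 / sqrt (g_fn s 0 z))) {0<..<1}"
    by blast
  have "((\<lambda>z. 1::real) has_integral 1) {0<..<1::real}"
    using has_integral_const_real[of "1::real" 0 1] by (simp add: has_integral_Icc_iff_Ioo)
  then have "1 \<le> integral {0<..<1} (\<lambda>z. 1 / sqrt (g_fn s 0 z))"
  proof (rule has_integral_le[OF _ I])
    fix z :: real assume z: "z \<in> {0<..<1}"
    then show "1 \<le> 1 / sqrt (g_fn s 0 z)"
      using g_fn_pos[OF s, of 0 z] g_fn_le[OF s, of 0 z] by simp
  qed
  then show ?thesis by simp
qed

text \<open>Near \<open>pi\<close> the quotient \<open>y / sin x\<close>, where \<open>x = phi_fn s y\<close>, is rewritten through \<open>x = y * I y\<close>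
  as \<open>1 / (I y * (sin x / x))\<close>, which removes the indeterminate form.\<close>

lemma b_formula_converges: "\<exists>L. (b_formula s \<longlongrightarrow> L) (at_left pi)"
proof -
  define I where "I y = integral {0<..<1} (\<lambda>z. 1 / sqrt (g_fn s y z))" for y
  define Y where "Y = y_fn s"
  define B where "B x = 2 powr (4 * s) / 4 * (1 - (Y x)\<^sup>2) powr (- 2 * s) *
    (1 + 2 * s * (Y x)\<^sup>2 / (1 - (Y x)\<^sup>2)) * (1 / (I (Y x) * (sin x / x) * cos x * dphi_fn s (Y x)))" for x
  have ev: "eventually (\<lambda>x. 0 < x \<and> x < pi / 2) (at_right (0::real))"
    using eventually_at_right_less eventually_at_right_field[of _ 0] pi_half_gt_zero
    by (auto simp: eventually_at_right_field intro!: exI[of _ "pi / 2"])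
  have Y0: "(Y \<longlongrightarrow> 0) (at_right 0)"
  proof -
    have "((\<lambda>x. Y x) \<longlongrightarrow> Y 0) (at_right 0)"
      unfolding Y_def
      by (rule continuous_on_tendsto_compose[OF continuous_on_y_fn[OF s]])
         (auto intro: eventually_mono[OF ev] tendsto_ident_at)
    moreover have "Y 0 = 0" using y_fn_phi_fn[OF s, of 0] phi_fn_0[OF s] by (simp add: Y_def)
    ultimately show ?thesis by simp
  qed
  have Ymem: "eventually (\<lambda>x. 0 < Y x \<and> Y x < 1) (at_right 0)"
    using ev by eventually_elim (auto simp: Y_def y_fn_mem_open[OF s])
  \<comment> \<open>Keeps \<open>Y x\<close> in \<open>{0..1 / 2}\<close>, as the continuity of
    \<open>dphi_fn\<close> is stated on intervals that end before 1.\<close>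
  have Yhalf: "eventually (\<lambda>x. Y x < 1 / 2) (at_right 0)"
    using order_tendstoD(2)[OF Y0, of "1 / 2"] by simp
  have I0: "((\<lambda>x. I (Y x)) \<longlongrightarrow> I 0) (at_right 0)"
    unfolding I_def
    by (rule continuous_on_tendsto_compose[OF continuous_on_mean_inverse_sqrt_g[OF s] Y0])
       (auto intro: eventually_mono[OF Ymem])
  have D0: "((\<lambda>x. dphi_fn s (Y x)) \<longlongrightarrow> dphi_fn s 0) (at_right 0)"
    by (rule continuous_on_tendsto_compose[OF continuous_on_dphi_fn[OF s, of "1 / 2"] Y0])
       (use eventually_conj[OF Ymem Yhalf] in \<open>auto elim: eventually_mono\<close>)
  \<comment> \<open>This is the difference quotient of the sine at 0.\<close>
  have "((\<lambda>x::real. sin x / x) \<longlongrightarrow> 1) (at 0)"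
    using DERIV_sin[of "0::real"] by (simp add: has_field_derivative_iff)
  then have sx: "((\<lambda>x::real. sin x / x) \<longlongrightarrow> 1) (at_right 0)"
    by (rule tendsto_mono[rotated]) (simp add: at_le)
  have "I 0 \<noteq> 0" using mean_inverse_sqrt_g_fn_0_pos by (simp add: I_def)
  moreover have "dphi_fn s 0 \<noteq> 0" using dphi_fn_pos[OF s, of 0] by simp
  ultimately have "(B \<longlongrightarrow> 2 powr (4 * s) / 4 * (1 - 0\<^sup>2) powr (- 2 * s) *
    (1 + 2 * s * 0\<^sup>2 / (1 - 0\<^sup>2)) * (1 / (I 0 * 1 * cos 0 * dphi_fn s 0))) (at_right 0)"
    unfolding B_def by (intro tendsto_intros Y0 I0 D0 sx) auto
  then obtain L where L: "(B \<longlongrightarrow> L) (at_right 0)" by blast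
  have "filterlim (\<lambda>\<theta>. (pi - \<theta>) / 2) (at_right 0) (at_left pi)"
    unfolding filterlim_at
    by (auto intro!: tendsto_eq_intros simp: eventually_at_left_field intro: exI[of _ 0])
  then have "((\<lambda>\<theta>. B ((pi - \<theta>) / 2)) \<longlongrightarrow> L) (at_left pi)"
    by (rule filterlim_compose[OF L])
  moreover have "eventually (\<lambda>\<theta>. B ((pi - \<theta>) / 2) = b_formula s \<theta>) (at_left pi)"
  proof -
    have "eventually (\<lambda>\<theta>. 0 < \<theta> \<and> \<theta> < pi) (at_left pi)"
      by (auto simp: eventually_at_left_field intro!: exI[of _ 0])
    then show ?thesis
    proof eventually_elim
      case (elim \<theta>)
      define x where "x = (pi - \<theta>) / 2"
      have x: "0 < x" "x < pi / 2" using elim by (auto simp: x_def)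
      have y: "0 < Y x" "Y x < 1" unfolding Y_def by (rule y_fn_mem_open[OF s x])+
      have px: "phi_fn s (Y x) = x" unfolding Y_def using x by (intro phi_fn_y_fn[OF s]) auto
      then have xI: "x = Y x * I (Y x)" using phi_fn_eq_mult[OF s, of "Y x"] by (simp add: I_def)
      have "I (Y x) / x = 1 / Y x" using xI x y
        by (metis div_by_1 mult.commute nonzero_divide_mult_cancel_left less_irrefl mult_zero_left)
      then have "I (Y x) / x * sin x = 1 / Y x * sin x" by (rule arg_cong)
      then have "I (Y x) * (sin x / x) = sin x / Y x" by simp
      then show ?case
        using b_formula_phi_fn[OF s y] unfolding px x_def[symmetric] B_def
        by (simp add: x_def field_simps)
    qed
  qed
  ultimately show ?thesis using Lim_transform_eventually by blast
qed

end

theorem theorem1p1: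
  fixes s \<theta> :: real
  assumes "0 < \<theta>" and "\<theta> \<le> pi"
    and "0 < s" and "s < 1"
  shows "\<bar>b_fn s \<theta> - 1 / 4\<bar> \<le> 50000 * s * \<theta> powr (- 2 - 2 * s)"
proof (cases "\<theta> = pi")
  case False
  then show ?thesis using b_formula_bound[of s \<theta>] assms by (simp add: b_fn_def)
next
  case True
  obtain L where L: "(b_formula s \<longlongrightarrow> L) (at_left pi)"
    using b_formula_converges assms by blast
  \<comment> \<open>The estimate for \<open>\<theta> < pi\<close> passes to the left limit, since
    both sides converge.\<close>
  have "\<bar>L - 1 / 4\<bar> \<le> 50000 * s * pi powr (- 2 - 2 * s)"
  proof (rule tendsto_le)
    show "((\<lambda>t. \<bar>b_formula s t - 1 / 4\<bar>) \<longlongrightarrow> \<bar>L - 1 / 4\<bar>) (at_left pi)"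
      by (intro tendsto_intros L)
    show "((\<lambda>t. 50000 * s * t powr (- 2 - 2 * s)) \<longlongrightarrow> 50000 * s * pi powr (- 2 - 2 * s)) (at_left pi)"
      by (intro tendsto_intros) auto
    have "eventually (\<lambda>t. 0 < t \<and> t < pi) (at_left pi)"
      by (auto simp: eventually_at_left_field intro!: exI[of _ 0])
    then show "eventually (\<lambda>t. \<bar>b_formula s t - 1 / 4\<bar> \<le> 50000 * s * t powr (- 2 - 2 * s)) (at_left pi)"
      using b_formula_bound assms by (auto elim: eventually_mono)
  qed simp
  moreover have "b_fn s pi = L"
    using tendsto_Lim[OF _ L] by (simp add: b_fn_def)
  ultimately show ?thesis using True by simp
qed

end
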